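(* Consider the setting described in the context, and assume A1–A5. Let $f_n=\sum_{j\ge1}\theta_{nj}\phi_j$ with $cn^{-r}\le\|f_n\|\le Cn^{-r}$ for constants $0<c<C$. Then the sequence of alternatives $f_n$ is inconsistent if and only if for every $c_2>0$ $$\sum_{j<c_2k_n}\theta_{nj}^2=o(n^{-2r})\quad\text{as }n\to\infty .$$
   Context: Fix $\sigma>0$, $0<r<1/2$ and an orthonormal basis $(\phi_j)_{j\ge1}$ of $\mathbb{L}_2(0,1)$. For each $n$ one observes $dY_n(t)=f(t)\,dt+\sigma n^{-1/2}dw(t)$, $t\in[0,1]$ ($w$ standard Wiener process, $f\in\mathbb{L}_2(0,1)$ unknown), equivalently $y_j=\theta_j+\sigma n^{-1/2}\xi_j$ with $\theta_j=\int_0^1f\phi_j$, $\xi_j$ i.i.d. $N(0,1)$. The hypothesis is $H_0: f=0$. For each $n$ nonnegative weights $\kappa_{nj}^2$ are given, $\rho_n=\sum_j\kappa_{nj}^2<\infty$, and $T_n(Y_n)=\sum_j\kappa_{nj}^2y_j^2-\sigma^2n^{-1}\rho_n$. Put $k_n=\sup\{k:\sum_{j<k}\kappa_{nj}^2\le\rho_n/2\}$, $\kappa_n^2=\kappa_{nk_n}^2$. Assumptions: (A1) $j\mapsto\kappa_{nj}^2$ is decreasing for each $n$; (A2) $C_1<A_n:=\sigma^{-4}n^2\sum_j\kappa_{nj}^4<C_2$ for all $n$, some $C_1,C_2>0$; (A3) $c_1n^{-2r}\le\rho_n\le c_2n^{-2r}$; (A4) there are $C_1>0,\lambda>1$ with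 $\kappa^2_{n,[(1+\delta)k_n]}<C_1(1+\delta)^{-\lambda}\kappa_n^2$ for all $\delta>0$ and all $n$; (A5) $\kappa_{n1}^2\asymp\kappa_n^2$, and for each $c>1$ there is $C>0$ with $\kappa^2_{n,[ck_n]}\ge C\kappa_n^2$ for all $n$. A test generated by $T_n$ rejects $H_0$ iff $T_n(Y_n)$ exceeds a threshold; $\alpha(K)$, $\beta(K,f)$ are type I and type II error probabilities. A sequence $f_n$ is inconsistent if for every sequence of tests $K_n$ generated by $T_n$, $\liminf_n(\alpha(K_n)+\beta(K_n,f_n))\ge1$. *)

theory Defs
  imports "HOL-Probability.Probability" "HOL-Library.Landau_Symbols"
begin

text \<open>Gaussian sequence model, indices j >= 1. The weights kappa_{nj}^2 are
  represented by w n j (index j >= 1; w n 0 is irrelevant).\<close>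

definition rho :: "(nat \<Rightarrow> real) \<Rightarrow> real" where
  "rho w = (\<Sum>j. w (Suc j))"

definition kn :: "(nat \<Rightarrow> real) \<Rightarrow> nat" where
  "kn w = Sup {k. (\<Sum>j\<in>{1..<k}. w j) \<le> rho w / 2}"

definition kappa2 :: "(nat \<Rightarrow> real) \<Rightarrow> real" where
  "kappa2 w = w (kn w)"

text \<open>Test statistic T_n evaluated at the observation y_j = theta_j + sigma n^{-1/2} x_j.\<close>
definition Tstat :: "(nat \<Rightarrow> real) \<Rightarrow> real \<Rightarrow> nat \<Rightarrow> (nat \<Rightarrow> real) \<Rightarrow> (nat \<Rightarrow> real) \<Rightarrow> real" where
  "Tstat w \<sigma> n \<theta> x =
     (\<Sum>j. w (Suc j) * (\<theta> (Suc j) + \<sigma> / sqrt (real n) * x (Suc j))\<^sup>2)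
     - \<sigma>\<^sup>2 / real n * rho w"

definition err1 :: "'a measure \<Rightarrow> (nat \<Rightarrow> 'a \<Rightarrow> real) \<Rightarrow> (nat \<Rightarrow> real) \<Rightarrow> real \<Rightarrow> nat \<Rightarrow> real \<Rightarrow> real" where
  "err1 M \<xi> w \<sigma> n t = measure M {\<omega>\<in>space M. Tstat w \<sigma> n (\<lambda>_. 0) (\<lambda>j. \<xi> j \<omega>) > t}"

definition err2 :: "'a measure \<Rightarrow> (nat \<Rightarrow> 'a \<Rightarrow> real) \<Rightarrow> (nat \<Rightarrow> real) \<Rightarrow> real \<Rightarrow> nat \<Rightarrow> (nat \<Rightarrow> real) \<Rightarrow> real \<Rightarrow> real" where
  "err2 M \<xi> w \<sigma> n \<theta> t = measure M {\<omega>\<in>space M. Tstat w \<sigma> n \<theta> (\<lambda>j. \<xi> j \<omega>) \<le> t}"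

end

theory Submission
  imports Defs
begin

text \<open>
  Up to an almost sure identity the test statistic is \<open>A + 2\<tau>U + \<tau>\<^sup>2(V - \<rho>)\<close> with \<open>\<tau> = \<sigma>/\<surd>n\<close>,
  signal \<open>A = \<Sum> w\<^sub>j\<theta>\<^sub>j\<^sup>2\<close>, linear noise \<open>U = \<Sum> w\<^sub>j\<theta>\<^sub>j\<xi>\<^sub>j\<close> and \<open>V = \<Sum> w\<^sub>j\<xi>\<^sub>j\<^sup>2\<close>. The assumptions give
  \<open>\<kappa>\<^sup>2 \<asymp> n\<close> to the power \<open>2r - 2\<close> and \<open>\<surd>k \<kappa>\<^sup>2 \<asymp> 1/n\<close>, so that \<open>V\<close> fluctuates on the scale \<open>1/n\<close>, the
  contribution of \<open>U\<close> is negligible, and the low frequency condition is equivalent to \<open>n\<^sup>2A \<rightarrow> 0\<close>.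

  If \<open>n\<^sup>2A\<close> does not tend to 0, then by Chebyshev half of the mass of \<open>V\<close> lies in an interval of
  length \<open>O(1/n)\<close>, which is covered by boundedly many intervals of the length \<open>A/(2\<tau>\<^sup>2)\<close>; a threshold at
  the right end of the heaviest one gives an error sum bounded away from 1.

  If \<open>n\<^sup>2A \<rightarrow> 0\<close>, one needs that \<open>V\<close> puts mass \<open>O(\<epsilon>) + o(1)\<close> on every interval of length \<open>\<epsilon>\<surd>k \<kappa>\<^sup>2\<close>.
  Multiply the first \<open>k\<close> coordinates of the noise by \<open>s\<close> with \<open>s\<^sup>2 = 1 + \<epsilon>/\<surd>k\<close>. The likelihood ratio
  has second moment \<open>(1 - \<epsilon>\<^sup>2/k)\<close> to the power \<open>-k/2\<close>, so the law changes by \<open>O(\<epsilon>)\<close> in total variation,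
  whereas \<open>V\<close> grows by at least \<open>\<epsilon>\<surd>k \<kappa>\<^sup>2/2\<close> outside an event of probability \<open>O(1/k)\<close>.
\<close>

section \<open>Independent standard normal sequences\<close>

lemma (in prob_space) prob_le_add_AE:
  assumes [measurable]: "A \<in> events" "B \<in> events" "C \<in> events"
    and "AE \<omega> in M. \<omega> \<in> A \<longrightarrow> \<omega> \<in> B \<or> \<omega> \<in> C"
  shows "prob A \<le> prob B + prob C"
proof -
  have "prob A \<le> prob (B \<union> C)"
    using assms by (intro finite_measure_mono_AE) auto
  also have "\<dots> \<le> prob B + prob C"
    by (intro measure_Un_le) auto
  finally show ?thesis .
qed

lemma (in prob_space) orthogonal_series_prob_le:
  fixes Z :: "nat \<Rightarrow> 'a \<Rightarrow> real" and b :: "nat \<Rightarrow> real"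
  assumes meas[measurable]: "\<And>j. random_variable borel (Z j)"
    and int: "\<And>i j. integrable M (\<lambda>\<omega>. Z i \<omega> * Z j \<omega>)"
    and orth: "\<And>i j. i \<noteq> j \<Longrightarrow> expectation (\<lambda>\<omega>. Z i \<omega> * Z j \<omega>) = 0"
    and var: "\<And>j. expectation (\<lambda>\<omega>. Z j \<omega> * Z j \<omega>) \<le> v"
    and b: "summable (\<lambda>j. (b j)\<^sup>2)"
    and conv: "AE \<omega> in M. summable (\<lambda>j. b j * Z j \<omega>)"
    and d: "d > 0"
  shows "prob {\<omega>\<in>space M. d \<le> \<bar>\<Sum>j. b j * Z j \<omega>\<bar>} \<le> v * (\<Sum>j. (b j)\<^sup>2) / d\<^sup>2"
proof -
  let ?S = "\<lambda>N \<omega>. \<Sum>j<N. b j * Z j \<omega>" and ?B = "\<Sum>j. (b j)\<^sup>2"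
  have "0 \<le> expectation (\<lambda>\<omega>. Z 0 \<omega> * Z 0 \<omega>)"
    by (intro Bochner_Integration.integral_nonneg) simp
  then have v: "0 \<le> v"
    using var[of 0] by linarith
  have B: "0 \<le> ?B"
    by (intro suminf_nonneg b) simp
  have sq: "(?S N \<omega>)\<^sup>2 = (\<Sum>i<N. \<Sum>j<N. b i * b j * (Z i \<omega> * Z j \<omega>))" for N \<omega>
    unfolding power2_eq_square sum_product by (intro sum.cong refl) (simp add: mult_ac)
  have S_int: "integrable M (\<lambda>\<omega>. (?S N \<omega>)\<^sup>2)" for N
    unfolding sq by (intro Bochner_Integration.integrable_sum integrable_mult_right int)
  have S_le: "expectation (\<lambda>\<omega>. (?S N \<omega>)\<^sup>2) \<le> v * ?B" for N
  proof -
    have "expectation (\<lambda>\<omega>. (?S N \<omega>)\<^sup>2)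
        = (\<Sum>i<N. \<Sum>j<N. b i * b j * expectation (\<lambda>\<omega>. Z i \<omega> * Z j \<omega>))"
      unfolding sq by (simp add: int Bochner_Integration.integral_sum)
    also have "\<dots> = (\<Sum>i<N. \<Sum>j<N. if j = i then (b i)\<^sup>2 * expectation (\<lambda>\<omega>. Z i \<omega> * Z i \<omega>) else 0)"
      by (intro sum.cong refl) (auto simp: orth power2_eq_square)
    also have "\<dots> = (\<Sum>i<N. (b i)\<^sup>2 * expectation (\<lambda>\<omega>. Z i \<omega> * Z i \<omega>))"
      by (simp add: sum.delta)
    also have "\<dots> \<le> (\<Sum>i<N. (b i)\<^sup>2 * v)"
      by (intro sum_mono mult_left_mono var) simp
    also have "\<dots> = v * (\<Sum>i<N. (b i)\<^sup>2)"
      by (simp add: sum_distrib_left mult_ac)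
    also have "\<dots> \<le> v * ?B"
      by (intro mult_left_mono sum_le_suminf b v) auto
    finally show ?thesis .
  qed
  have "(\<integral>\<^sup>+\<omega>. ennreal ((\<Sum>j. b j * Z j \<omega>)\<^sup>2) \<partial>M)
      = (\<integral>\<^sup>+\<omega>. liminf (\<lambda>N. ennreal ((?S N \<omega>)\<^sup>2)) \<partial>M)"
  proof (rule nn_integral_cong_AE)
    show "AE \<omega> in M. ennreal ((\<Sum>j. b j * Z j \<omega>)\<^sup>2) = liminf (\<lambda>N. ennreal ((?S N \<omega>)\<^sup>2))"
      using conv
    proof eventually_elim
      case (elim \<omega>)
      have "(\<lambda>N. ennreal ((?S N \<omega>)\<^sup>2)) \<longlonglongrightarrow> ennreal ((\<Sum>j. b j * Z j \<omega>)\<^sup>2)"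
        by (intro tendsto_ennrealI tendsto_power summable_LIMSEQ elim)
      then show ?case
        by (intro lim_imp_Liminf[symmetric]) auto
    qed
  qed
  also have "\<dots> \<le> liminf (\<lambda>N. \<integral>\<^sup>+\<omega>. ennreal ((?S N \<omega>)\<^sup>2) \<partial>M)"
    by (intro nn_integral_liminf) simp
  also have "\<dots> \<le> liminf (\<lambda>N::nat. ennreal (v * ?B))"
    using S_le by (intro Liminf_mono always_eventually allI)
      (subst nn_integral_eq_integral[OF S_int], auto intro: ennreal_leI)
  also have "\<dots> = ennreal (v * ?B)"
    by (simp add: Liminf_const)
  finally have E: "(\<integral>\<^sup>+\<omega>. ennreal ((\<Sum>j. b j * Z j \<omega>)\<^sup>2) \<partial>M) \<le> ennreal (v * ?B)" .
  have "emeasure M {\<omega>\<in>space M. d \<le> \<bar>\<Sum>j. b j * Z j \<omega>\<bar>}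
      = emeasure M {\<omega>\<in>space M. 1 \<le> ennreal (1 / d\<^sup>2) * ennreal ((\<Sum>j. b j * Z j \<omega>)\<^sup>2)}"
    using d by (intro arg_cong[where f = "emeasure M"] Collect_cong conj_cong refl)
      (simp add: ennreal_mult[symmetric] abs_le_square_iff[symmetric] flip: ennreal_1)
  also have "\<dots> \<le> ennreal (1 / d\<^sup>2) *
      (\<integral>\<^sup>+\<omega>. ennreal ((\<Sum>j. b j * Z j \<omega>)\<^sup>2) * indicator (space M) \<omega> \<partial>M)"
    by (intro nn_integral_Markov_inequality) auto
  also have "(\<integral>\<^sup>+\<omega>. ennreal ((\<Sum>j. b j * Z j \<omega>)\<^sup>2) * indicator (space M) \<omega> \<partial>M)
      = (\<integral>\<^sup>+\<omega>. ennreal ((\<Sum>j. b j * Z j \<omega>)\<^sup>2) \<partial>M)"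
    by (intro nn_integral_cong) simp
  also have "ennreal (1 / d\<^sup>2) * \<dots> \<le> ennreal (1 / d\<^sup>2) * ennreal (v * ?B)"
    by (intro mult_left_mono E) simp
  also have "\<dots> = ennreal (v * ?B / d\<^sup>2)"
    using v B by (simp add: ennreal_mult[symmetric])
  finally show ?thesis
    using v B by (simp add: emeasure_eq_measure)
qed

lemma (in prob_space) indep_vars_reindex_inj:
  assumes ind: "indep_vars (\<lambda>_. N) X UNIV" and inj: "inj f"
  shows "indep_vars (\<lambda>_. N) (\<lambda>j. X (f j)) UNIV"
proof -
  have "indep_sets (\<lambda>i. {X (f i) -` A \<inter> space M | A. A \<in> sets N}) UNIV"
  proof (rule indep_setsI)
    fix i show "{X (f i) -` A \<inter> space M | A. A \<in> sets N} \<subseteq> events"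
      using ind by (auto simp: indep_vars_def2 intro: measurable_sets)
  next
    fix A J assume J: "J \<noteq> {}" "finite J" "\<forall>j\<in>J. A j \<in> {X (f j) -` B \<inter> space M | B. B \<in> sets N}"
    have [simp]: "inv f (f j) = j" for j
      by (rule inv_f_f[OF inj])
    have "prob (\<Inter>j\<in>f ` J. A (inv f j)) = (\<Prod>j\<in>f ` J. prob (A (inv f j)))"
      using J ind by (intro indep_setsD[of "\<lambda>i. {X i -` B \<inter> space M | B. B \<in> sets N}" UNIV])
        (auto simp: indep_vars_def2)
    then show "prob (\<Inter>j\<in>J. A j) = (\<Prod>j\<in>J. prob (A j))"
      by (simp add: prod.reindex[OF inj_on_subset[OF inj]])
  qed
  then show ?thesis
    using ind unfolding indep_vars_def2 by auto
qed

locale std_normal_seq = prob_space +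
  fixes X :: "nat \<Rightarrow> 'a \<Rightarrow> real"
  assumes indep: "indep_vars (\<lambda>_. borel) X UNIV"
    and gauss: "\<And>j. distributed M lborel (X j) std_normal_density"
begin

lemma X_measurable[measurable]: "random_variable borel (X j)"
  using indep by (simp add: indep_vars_def)

lemma integrable_X_power: "integrable M (\<lambda>\<omega>. X j \<omega> ^ m)"
  using distributed_integrable[OF gauss, of "\<lambda>x. x ^ m" j] integrable_std_normal_moment[of m]
  by simp

lemma expectation_X_power:
  "expectation (\<lambda>\<omega>. X j \<omega> ^ m) = (\<integral>x. std_normal_density x * x ^ m \<partial>lborel)"
  by (rule distributed_integral[OF gauss, symmetric]) auto

lemma expectation_X: "expectation (X j) = 0"
  using expectation_X_power[of j 1] integral_std_normal_moment_odd[of 0] by simp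

lemma expectation_X2: "expectation (\<lambda>\<omega>. (X j \<omega>)\<^sup>2) = 1"
  using expectation_X_power[of j 2] integral_std_normal_moment_even[of 1] by simp

lemma expectation_X4: "expectation (\<lambda>\<omega>. X j \<omega> ^ 4) = 3"
  using expectation_X_power[of j 4] integral_std_normal_moment_even[of 2] by (simp add: fact_numeral)

lemma indep_expectation_mult:
  fixes f g :: "real \<Rightarrow> real"
  assumes [measurable]: "f \<in> borel_measurable borel" "g \<in> borel_measurable borel"
    and "i \<noteq> j" "integrable M (\<lambda>\<omega>. f (X i \<omega>))" "integrable M (\<lambda>\<omega>. g (X j \<omega>))"
  shows "integrable M (\<lambda>\<omega>. f (X i \<omega>) * g (X j \<omega>))"
    and "expectation (\<lambda>\<omega>. f (X i \<omega>) * g (X j \<omega>))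
       = expectation (\<lambda>\<omega>. f (X i \<omega>)) * expectation (\<lambda>\<omega>. g (X j \<omega>))"
proof -
  let ?h = "\<lambda>l \<omega>. (if l = i then f else g) (X l \<omega>)"
  have ind: "indep_vars (\<lambda>_. borel) ?h {i, j}"
    by (rule indep_vars_compose2[OF indep_vars_subset[OF indep]]) auto
  have int: "integrable M (?h l)" if "l \<in> {i, j}" for l
    using assms that by auto
  show "integrable M (\<lambda>\<omega>. f (X i \<omega>) * g (X j \<omega>))"
    using indep_vars_integrable[OF _ ind int] \<open>i \<noteq> j\<close> by simp
  show "expectation (\<lambda>\<omega>. f (X i \<omega>) * g (X j \<omega>))
       = expectation (\<lambda>\<omega>. f (X i \<omega>)) * expectation (\<lambda>\<omega>. g (X j \<omega>))"
    using indep_vars_lebesgue_integral[OF _ ind int] \<open>i \<noteq> j\<close> by simp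
qed

lemma AE_summable_squares:
  assumes a: "\<And>j. 0 \<le> a j" "summable a"
  shows "AE \<omega> in M. summable (\<lambda>j. a j * (X j \<omega>)\<^sup>2)"
proof -
  have nn_term: "(\<integral>\<^sup>+\<omega>. ennreal (a j * (X j \<omega>)\<^sup>2) \<partial>M) = ennreal (a j)" for j
    using a integrable_X_power[of j 2]
    by (subst nn_integral_eq_integral) (auto simp: expectation_X2)
  have "(\<integral>\<^sup>+\<omega>. (\<Sum>j. ennreal (a j * (X j \<omega>)\<^sup>2)) \<partial>M) = (\<Sum>j. ennreal (a j))"
    by (subst nn_integral_suminf) (auto simp: nn_term)
  also have "\<dots> = ennreal (suminf a)"
    by (rule suminf_ennreal2[OF a])
  finally have "(\<integral>\<^sup>+\<omega>. (\<Sum>j. ennreal (a j * (X j \<omega>)\<^sup>2)) \<partial>M) \<noteq> \<infinity>"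
    by simp
  then have "AE \<omega> in M. (\<Sum>j. ennreal (a j * (X j \<omega>)\<^sup>2)) \<noteq> \<infinity>"
    by (intro nn_integral_noteq_infinite) auto
  then show ?thesis
    by eventually_elim (rule summable_suminf_not_top, use a in auto)
qed

lemma prob_linear_le:
  assumes b: "summable (\<lambda>j. (b j)\<^sup>2)" and conv: "AE \<omega> in M. summable (\<lambda>j. b j * X j \<omega>)"
    and d: "d > 0"
  shows "prob {\<omega>\<in>space M. d \<le> \<bar>\<Sum>j. b j * X j \<omega>\<bar>} \<le> (\<Sum>j. (b j)\<^sup>2) / d\<^sup>2"
proof -
  have i1: "integrable M (X j)" for j
    using integrable_X_power[of j 1] by simp
  have "integrable M (\<lambda>\<omega>. X i \<omega> * X j \<omega>)" for i j
    using integrable_X_power[of j 2] indep_expectation_mult(1)[of "\<lambda>x. x" "\<lambda>x. x" i j] i1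
    by (cases "i = j") (auto simp: power2_eq_square)
  moreover have "expectation (\<lambda>\<omega>. X i \<omega> * X j \<omega>) = 0" if "i \<noteq> j" for i j
    using indep_expectation_mult(2)[of "\<lambda>x. x" "\<lambda>x. x" i j] i1 that by (simp add: expectation_X)
  moreover have "expectation (\<lambda>\<omega>. X j \<omega> * X j \<omega>) \<le> 1" for j
    using expectation_X2[of j] by (simp add: power2_eq_square)
  ultimately show ?thesis
    using orthogonal_series_prob_le[of X 1, OF _ _ _ _ b conv d] by simp
qed

lemma prob_quadratic_le:
  assumes b: "summable (\<lambda>j. (b j)\<^sup>2)" and conv: "AE \<omega> in M. summable (\<lambda>j. b j * ((X j \<omega>)\<^sup>2 - 1))"
    and d: "d > 0"
  shows "prob {\<omega>\<in>space M. d \<le> \<bar>\<Sum>j. b j * ((X j \<omega>)\<^sup>2 - 1)\<bar>} \<le> 2 * (\<Sum>j. (b j)\<^sup>2) / d\<^sup>2"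
proof (rule orthogonal_series_prob_le[OF _ _ _ _ b conv d])
  have i2: "integrable M (\<lambda>\<omega>. (X j \<omega>)\<^sup>2 - 1)" for j
    by (intro Bochner_Integration.integrable_diff integrable_X_power) simp
  have e2: "expectation (\<lambda>\<omega>. (X j \<omega>)\<^sup>2 - 1) = 0" for j
    by (subst Bochner_Integration.integral_diff) (auto simp: integrable_X_power expectation_X2 prob_space)
  have sq: "((X j \<omega>)\<^sup>2 - 1) * ((X j \<omega>)\<^sup>2 - 1) = X j \<omega> ^ 4 - 2 * (X j \<omega>)\<^sup>2 + 1" for j \<omega>
    by (simp add: power2_eq_square power4_eq_xxxx algebra_simps)
  have isq: "integrable M (\<lambda>\<omega>. ((X j \<omega>)\<^sup>2 - 1) * ((X j \<omega>)\<^sup>2 - 1))" for j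
    unfolding sq by (intro Bochner_Integration.integrable_add Bochner_Integration.integrable_diff
        integrable_mult_right integrable_X_power) simp
  show "expectation (\<lambda>\<omega>. ((X j \<omega>)\<^sup>2 - 1) * ((X j \<omega>)\<^sup>2 - 1)) \<le> 2" for j
    unfolding sq by (simp add: integrable_X_power expectation_X2 expectation_X4 prob_space)
  show "random_variable borel (\<lambda>\<omega>. (X j \<omega>)\<^sup>2 - 1)" for j
    by measurable
  show "integrable M (\<lambda>\<omega>. ((X i \<omega>)\<^sup>2 - 1) * ((X j \<omega>)\<^sup>2 - 1))" for i j
    using isq indep_expectation_mult(1)[where f = "\<lambda>x. x\<^sup>2 - 1" and g = "\<lambda>x. x\<^sup>2 - 1" and i = i and j = j] i2
    by (cases "i = j") auto
  show "expectation (\<lambda>\<omega>. ((X i \<omega>)\<^sup>2 - 1) * ((X j \<omega>)\<^sup>2 - 1)) = 0" if "i \<noteq> j" for i j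
    using indep_expectation_mult(2)[where f = "\<lambda>x. x\<^sup>2 - 1" and g = "\<lambda>x. x\<^sup>2 - 1" and i = i and j = j] i2 that e2
    by auto
qed

end

section \<open>Rescaling the first coordinates\<close>

definition normal_lr :: "real \<Rightarrow> real \<Rightarrow> real" where
  "normal_lr s x = normal_density 0 s x / std_normal_density x"

lemma normal_lr_nonneg[simp]: "0 \<le> normal_lr s x"
  by (simp add: normal_lr_def)

lemma normal_lr_measurable[measurable]: "normal_lr s \<in> borel_measurable borel"
  unfolding normal_lr_def[abs_def] by measurable

lemma std_normal_density_times_lr: "std_normal_density x * normal_lr s x = normal_density 0 s x"
  using normal_density_pos[of 1 0 x] by (simp add: normal_lr_def)

lemma std_normal_density_times_lr_squared:
  assumes s: "0 < s" "s\<^sup>2 < 2"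
  shows "std_normal_density x * (normal_lr s x)\<^sup>2
       = 1 / (s * sqrt (2 - s\<^sup>2)) * normal_density 0 (s / sqrt (2 - s\<^sup>2)) x"
proof -
  define q where "q = sqrt (2 - s\<^sup>2)"
  have q: "q > 0" "q\<^sup>2 = 2 - s\<^sup>2"
    using s by (auto simp: q_def)
  define p where "p = sqrt (2 * pi)"
  have p: "p > 0"
    by (simp add: p_def)
  have sq: "sqrt (2 * pi * t\<^sup>2) = p * t" if "t > 0" for t
    using that by (simp add: p_def real_sqrt_mult)
  have "std_normal_density x * (normal_lr s x)\<^sup>2 = (normal_density 0 s x)\<^sup>2 / std_normal_density x"
    by (simp add: normal_lr_def power2_eq_square)
  also have "\<dots> = 1 / (p * s\<^sup>2) * (exp (- x\<^sup>2 / (2 * s\<^sup>2)) ^ 2 / exp (- x\<^sup>2 / 2))"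
    using p s sq[of s] sq[of 1] by (simp add: normal_density_def power2_eq_square field_simps)
  also have "exp (- x\<^sup>2 / (2 * s\<^sup>2)) ^ 2 / exp (- x\<^sup>2 / 2) = exp (- x\<^sup>2 / (2 * (s / q)\<^sup>2))"
    using s q by (simp add: exp_of_nat_mult[symmetric] exp_diff[symmetric] power_divide)
      (simp add: field_simps)
  also have "1 / (p * s\<^sup>2) * exp (- x\<^sup>2 / (2 * (s / q)\<^sup>2)) = 1 / (s * q) * normal_density 0 (s / q) x"
    using s q p sq[of "s / q"] by (simp add: normal_density_def power2_eq_square field_simps)
  finally show ?thesis
    by (simp add: q_def)
qed

context std_normal_seq
begin

lemma nn_integral_normal_lr:
  assumes s: "0 < s" and A[measurable]: "A \<in> sets borel"
  shows "(\<integral>\<^sup>+\<omega>. ennreal (normal_lr s (X j \<omega>) * indicator A (X j \<omega>)) \<partial>M)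
       = (\<integral>\<^sup>+\<omega>. ennreal (indicator A (s * X j \<omega>)) \<partial>M)"
proof -
  have sX: "distributed M lborel (\<lambda>\<omega>. s * X j \<omega>) (normal_density 0 s)"
    using normal_density_affine[OF gauss, of s 0 j] s by simp
  have "(\<integral>\<^sup>+\<omega>. ennreal (normal_lr s (X j \<omega>) * indicator A (X j \<omega>)) \<partial>M)
      = (\<integral>\<^sup>+x. ennreal (std_normal_density x) * ennreal (normal_lr s x * indicator A x) \<partial>lborel)"
    by (rule distributed_nn_integral[OF gauss, symmetric]) simp
  also have "\<dots> = (\<integral>\<^sup>+x. ennreal (normal_density 0 s x) * ennreal (indicator A x) \<partial>lborel)"
    by (intro nn_integral_cong)
      (simp add: ennreal_mult[symmetric] mult.assoc[symmetric] std_normal_density_times_lr)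
  also have "\<dots> = (\<integral>\<^sup>+\<omega>. ennreal (indicator A (s * X j \<omega>)) \<partial>M)"
    by (rule distributed_nn_integral[OF sX]) simp
  finally show ?thesis .
qed

lemma normal_lr_moments:
  assumes s: "0 < s" "s\<^sup>2 < 2"
  shows "integrable M (\<lambda>\<omega>. normal_lr s (X j \<omega>))"
    and "expectation (\<lambda>\<omega>. normal_lr s (X j \<omega>)) = 1"
    and "integrable M (\<lambda>\<omega>. (normal_lr s (X j \<omega>))\<^sup>2)"
    and "expectation (\<lambda>\<omega>. (normal_lr s (X j \<omega>))\<^sup>2) = 1 / (s * sqrt (2 - s\<^sup>2))"
proof -
  have q: "s / sqrt (2 - s\<^sup>2) > 0"
    using s by simp
  have [simp]: "integrable lborel (normal_density 0 s)" "(\<integral>x. normal_density 0 s x \<partial>lborel) = 1"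
     "integrable lborel (normal_density 0 (s / sqrt (2 - s\<^sup>2)))"
     "(\<integral>x. normal_density 0 (s / sqrt (2 - s\<^sup>2)) x \<partial>lborel) = 1"
    using s q by auto
  show "integrable M (\<lambda>\<omega>. normal_lr s (X j \<omega>))"
    by (subst distributed_integrable[OF gauss, symmetric]) (auto simp: std_normal_density_times_lr)
  show "expectation (\<lambda>\<omega>. normal_lr s (X j \<omega>)) = 1"
    by (subst distributed_integral[OF gauss, symmetric]) (auto simp: std_normal_density_times_lr)
  show "integrable M (\<lambda>\<omega>. (normal_lr s (X j \<omega>))\<^sup>2)"
    by (subst distributed_integrable[OF gauss, symmetric])
      (auto simp: std_normal_density_times_lr_squared[OF s])
  show "expectation (\<lambda>\<omega>. (normal_lr s (X j \<omega>))\<^sup>2) = 1 / (s * sqrt (2 - s\<^sup>2))"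
    by (subst distributed_integral[OF gauss, symmetric])
      (auto simp: std_normal_density_times_lr_squared[OF s])
qed

definition scale_lr :: "real \<Rightarrow> nat \<Rightarrow> 'a \<Rightarrow> real" where
  "scale_lr s k \<omega> = (\<Prod>j<k. normal_lr s (X j \<omega>))"

lemma scale_lr_nonneg[simp]: "0 \<le> scale_lr s k \<omega>"
  by (simp add: scale_lr_def prod_nonneg)

lemma scale_lr_measurable[measurable]: "scale_lr s k \<in> borel_measurable M"
  unfolding scale_lr_def[abs_def] by measurable

lemma scale_lr_moments:
  assumes s: "0 < s" "s\<^sup>2 < 2"
  shows "integrable M (scale_lr s k)"
    and "expectation (scale_lr s k) = 1"
    and "integrable M (\<lambda>\<omega>. (scale_lr s k \<omega>)\<^sup>2)"
    and "expectation (\<lambda>\<omega>. (scale_lr s k \<omega>)\<^sup>2) = (1 / (s * sqrt (2 - s\<^sup>2))) ^ k"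
proof -
  have ind: "indep_vars (\<lambda>_. borel) (\<lambda>i \<omega>. h (X i \<omega>)) {..<k}"
    if "h \<in> borel_measurable borel" for h :: "real \<Rightarrow> real"
    by (rule indep_vars_compose2[OF indep_vars_subset[OF indep]]) (use that in auto)
  note m = normal_lr_moments[OF s]
  have sq: "(scale_lr s k \<omega>)\<^sup>2 = (\<Prod>j<k. (normal_lr s (X j \<omega>))\<^sup>2)" for \<omega>
    by (simp add: scale_lr_def prod_power_distrib)
  show "integrable M (scale_lr s k)" "expectation (scale_lr s k) = 1"
    using indep_vars_integrable[OF _ ind, of "normal_lr s"]
      indep_vars_lebesgue_integral[OF _ ind, of "normal_lr s"] m
    by (auto simp: scale_lr_def[abs_def])
  show "integrable M (\<lambda>\<omega>. (scale_lr s k \<omega>)\<^sup>2)"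
    "expectation (\<lambda>\<omega>. (scale_lr s k \<omega>)\<^sup>2) = (1 / (s * sqrt (2 - s\<^sup>2))) ^ k"
    using indep_vars_integrable[OF _ ind, of "\<lambda>x. (normal_lr s x)\<^sup>2"]
      indep_vars_lebesgue_integral[OF _ ind, of "\<lambda>x. (normal_lr s x)\<^sup>2"] m
    by (auto simp: sq)
qed

lemma distr_scaled_eq:
  assumes s: "0 < s"
  shows "distr (density M (scale_lr s k)) (PiM UNIV (\<lambda>_. borel)) (\<lambda>\<omega> j. X j \<omega>)
       = distr M (PiM UNIV (\<lambda>_. borel)) (\<lambda>\<omega> j. (if j < k then s else 1) * X j \<omega>)"
    (is "?P = ?Q")
proof (rule measure_eqI_PiM_infinite[symmetric])
  let ?c = "\<lambda>j. if j < k then s else 1 :: real"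
  have m1[measurable]: "(\<lambda>\<omega> j. X j \<omega>) \<in> measurable M (PiM UNIV (\<lambda>_. borel))"
    by (rule measurable_PiM_single') auto
  have m2[measurable]: "(\<lambda>\<omega> j. ?c j * X j \<omega>) \<in> measurable M (PiM UNIV (\<lambda>_. borel))"
    by (rule measurable_PiM_single') auto
  show "sets ?P = PiM UNIV (\<lambda>_. borel)" "sets ?Q = PiM UNIV (\<lambda>_. borel)"
    by simp_all
  show "finite_measure ?Q"
    by (intro prob_space.finite_measure prob_space_distr) simp
  fix A :: "nat \<Rightarrow> real set" and J :: "nat set"
  assume J: "finite J" and A: "\<And>i. i \<in> J \<Longrightarrow> A i \<in> sets borel"
  define B where "B i = (if i \<in> J then A i else UNIV)" for i
  have B[measurable]: "B i \<in> sets borel" for i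
    using A by (simp add: B_def)
  let ?K = "J \<union> {..<k}"
  let ?E = "prod_emb UNIV (\<lambda>_. borel :: real measure) J (Pi\<^sub>E J A)"
  have E: "?E = {f. \<forall>i\<in>?K. f i \<in> B i}"
    by (auto simp: prod_emb_def B_def PiE_iff restrict_def extensional_def split: if_splits)
  have [measurable]: "?E \<in> sets (PiM UNIV (\<lambda>_. borel))"
    using J A by (intro sets_PiM_I) auto
  have ind_prod: "indicator ?E f = (\<Prod>i\<in>?K. indicator (B i) (f i) :: real)" for f
  proof (cases "f \<in> ?E")
    case True
    then show ?thesis unfolding E by (auto intro!: prod.neutral[symmetric])
  next
    case False
    then obtain i where "i \<in> ?K" "f i \<notin> B i" unfolding E by blast
    then have "(\<Prod>i\<in>?K. indicator (B i) (f i) :: real) = 0"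
      using J by (intro prod_zero bexI[of _ i]) auto
    with False show ?thesis by simp
  qed
  define g where "g i x = (if i < k then normal_lr s x else 1) * indicator (B i) x" for i :: nat and x
  have [measurable]: "g i \<in> borel_measurable borel" for i
    unfolding g_def[abs_def] by (cases "i < k") auto
  have lr: "scale_lr s k \<omega> = (\<Prod>i\<in>?K. if i < k then normal_lr s (X i \<omega>) else 1)" for \<omega>
    using J unfolding scale_lr_def by (intro prod.mono_neutral_cong_left) auto
  have factor: "(\<integral>\<^sup>+\<omega>. ennreal (g i (X i \<omega>)) \<partial>M) = (\<integral>\<^sup>+\<omega>. ennreal (indicator (B i) (?c i * X i \<omega>)) \<partial>M)" for i
    using nn_integral_normal_lr[OF s B, of i i] by (cases "i < k") (auto simp: g_def)
  have "emeasure ?P ?E = emeasure (density M (scale_lr s k)) ((\<lambda>\<omega> j. X j \<omega>) -` ?E \<inter> space M)"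
    by (subst emeasure_distr) auto
  also have "\<dots> = (\<integral>\<^sup>+\<omega>. ennreal (scale_lr s k \<omega>) * indicator ((\<lambda>\<omega> j. X j \<omega>) -` ?E \<inter> space M) \<omega> \<partial>M)"
    by (intro emeasure_density) auto
  also have "\<dots> = (\<integral>\<^sup>+\<omega>. (\<Prod>i\<in>?K. ennreal (g i (X i \<omega>))) \<partial>M)"
  proof (intro nn_integral_cong)
    fix \<omega> assume "\<omega> \<in> space M"
    then have "ennreal (scale_lr s k \<omega>) * indicator ((\<lambda>\<omega> j. X j \<omega>) -` ?E \<inter> space M) \<omega>
       = ennreal (scale_lr s k \<omega> * indicator ?E (\<lambda>j. X j \<omega>))"
      by (auto split: split_indicator)
    also have "\<dots> = ennreal (\<Prod>i\<in>?K. g i (X i \<omega>))"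
      unfolding lr ind_prod g_def prod.distrib ..
    also have "\<dots> = (\<Prod>i\<in>?K. ennreal (g i (X i \<omega>)))"
      by (intro prod_ennreal[symmetric]) (auto simp: g_def)
    finally show "ennreal (scale_lr s k \<omega>) * indicator ((\<lambda>\<omega> j. X j \<omega>) -` ?E \<inter> space M) \<omega>
      = (\<Prod>i\<in>?K. ennreal (g i (X i \<omega>)))" .
  qed
  also have "\<dots> = (\<Prod>i\<in>?K. \<integral>\<^sup>+\<omega>. ennreal (g i (X i \<omega>)) \<partial>M)"
    using J by (intro indep_vars_nn_integral indep_vars_compose2[OF indep_vars_subset[OF indep]]) auto
  also have "\<dots> = (\<Prod>i\<in>?K. \<integral>\<^sup>+\<omega>. ennreal (indicator (B i) (?c i * X i \<omega>)) \<partial>M)"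
    by (simp only: factor)
  also have "\<dots> = (\<integral>\<^sup>+\<omega>. (\<Prod>i\<in>?K. ennreal (indicator (B i) (?c i * X i \<omega>))) \<partial>M)"
    using J by (intro indep_vars_nn_integral[symmetric] indep_vars_compose2[OF indep_vars_subset[OF indep]]) auto
  also have "\<dots> = (\<integral>\<^sup>+\<omega>. indicator ((\<lambda>\<omega> j. ?c j * X j \<omega>) -` ?E \<inter> space M) \<omega> \<partial>M)"
  proof (intro nn_integral_cong)
    fix \<omega> assume "\<omega> \<in> space M"
    have "(\<Prod>i\<in>?K. ennreal (indicator (B i) (?c i * X i \<omega>)))
       = ennreal (\<Prod>i\<in>?K. indicator (B i) (?c i * X i \<omega>))"
      by (intro prod_ennreal) auto
    also have "\<dots> = ennreal (indicator ?E (\<lambda>j. ?c j * X j \<omega>))"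
      by (simp only: ind_prod)
    also have "\<dots> = indicator ((\<lambda>\<omega> j. ?c j * X j \<omega>) -` ?E \<inter> space M) \<omega>"
      using \<open>\<omega> \<in> space M\<close> by (auto split: split_indicator)
    finally show "(\<Prod>i\<in>?K. ennreal (indicator (B i) (?c i * X i \<omega>)))
      = indicator ((\<lambda>\<omega> j. ?c j * X j \<omega>) -` ?E \<inter> space M) \<omega>" .
  qed
  also have "\<dots> = emeasure M ((\<lambda>\<omega> j. ?c j * X j \<omega>) -` ?E \<inter> space M)"
    by (intro nn_integral_indicator) auto
  also have "\<dots> = emeasure ?Q ?E"
    by (subst emeasure_distr) auto
  finally show "emeasure ?Q ?E = emeasure ?P ?E" ..
qed

lemma prob_le_prob_scaled:
  fixes e :: real and k :: nat
  assumes e: "0 < e" "e \<le> 1 / 2" and k: "k \<ge> 1"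
    and B[measurable]: "B \<in> sets (PiM UNIV (\<lambda>_. borel))"
  defines "s \<equiv> sqrt (1 + e / sqrt (real k))"
  shows "prob {\<omega>\<in>space M. (\<lambda>j. X j \<omega>) \<in> B}
       \<le> prob {\<omega>\<in>space M. (\<lambda>j. (if j < k then s else 1) * X j \<omega>) \<in> B} + 2 * e"
proof -
  let ?u = "e / sqrt (real k)" and ?L = "scale_lr s k"
  let ?c = "\<lambda>j. if j < k then s else 1 :: real"
  have m1[measurable]: "(\<lambda>\<omega> j. X j \<omega>) \<in> measurable M (PiM UNIV (\<lambda>_. borel))"
    by (rule measurable_PiM_single') auto
  have m2[measurable]: "(\<lambda>\<omega> j. ?c j * X j \<omega>) \<in> measurable M (PiM UNIV (\<lambda>_. borel))"
    by (rule measurable_PiM_single') auto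
  have u: "0 < ?u" "?u \<le> 1 / 2"
  proof -
    show "0 < ?u" using e k by simp
    have "?u \<le> e / 1" using e k by (intro divide_left_mono) auto
    then show "?u \<le> 1 / 2" using e by linarith
  qed
  have s2: "s\<^sup>2 = 1 + ?u"
    using u unfolding s_def by simp
  have "?u < 1"
    using u by linarith
  then have s: "0 < s" "s\<^sup>2 < 2"
    using u(1) s2 unfolding s_def real_sqrt_gt_0_iff by linarith+
  note L = scale_lr_moments[OF s, of k]
  have "(s * sqrt (2 - s\<^sup>2)) = sqrt (1 - ?u\<^sup>2)"
    unfolding s2 unfolding s_def real_sqrt_mult[symmetric] by (simp add: power2_eq_square algebra_simps)
  moreover have "1 - ?u\<^sup>2 \<le> sqrt (1 - ?u\<^sup>2)"
  proof (rule real_le_rsqrt)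
    have "?u\<^sup>2 \<le> 1"
      using u by (intro power_le_one) linarith+
    then show "(1 - ?u\<^sup>2)\<^sup>2 \<le> 1 - ?u\<^sup>2"
      unfolding power2_eq_square[of "1 - ?u\<^sup>2"] by (intro mult_left_le) auto
  qed
  moreover have u2: "?u\<^sup>2 \<le> 1 / 4"
    using power_mono[OF u(2), of 2] u(1) by (simp add: power2_eq_square)
  ultimately have "(1 - ?u\<^sup>2) ^ k \<le> (s * sqrt (2 - s\<^sup>2)) ^ k" "0 < 1 - ?u\<^sup>2"
    by (auto intro!: power_mono)
  moreover have "1 - e\<^sup>2 \<le> (1 - ?u\<^sup>2) ^ k"
    using Bernoulli_inequality[of "- ?u\<^sup>2" k] u2 k by (simp add: power_divide)
  ultimately have "1 - e\<^sup>2 \<le> (s * sqrt (2 - s\<^sup>2)) ^ k"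
    by linarith
  moreover have e2: "e\<^sup>2 \<le> 1 / 4"
    using power_mono[OF e(2), of 2] e(1) by (simp add: power2_eq_square)
  ultimately have "(1 / (s * sqrt (2 - s\<^sup>2))) ^ k \<le> 1 / (1 - e\<^sup>2)"
    unfolding power_one_over by (intro divide_left_mono) auto
  also have "1 / (1 - e\<^sup>2) \<le> 1 + 2 * e\<^sup>2"
  proof -
    have "0 \<le> e\<^sup>2 * (1 - 2 * e\<^sup>2)"
      using e2 by (intro mult_nonneg_nonneg) auto
    then have "1 \<le> (1 + 2 * e\<^sup>2) * (1 - e\<^sup>2)"
      by (simp add: algebra_simps)
    then show ?thesis
      using e2 by (simp add: divide_le_eq)
  qed
  finally have L2: "expectation (\<lambda>\<omega>. (?L \<omega>)\<^sup>2) \<le> 1 + 2 * e\<^sup>2"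
    by (simp add: L)
  have sqL: "(?L \<omega> - 1)\<^sup>2 = (?L \<omega>)\<^sup>2 - 2 * ?L \<omega> + 1" for \<omega>
    by (simp add: power2_eq_square algebra_simps)
  have var_int: "integrable M (\<lambda>\<omega>. (?L \<omega> - 1)\<^sup>2)"
    unfolding sqL using L by auto
  have var: "expectation (\<lambda>\<omega>. (?L \<omega> - 1)\<^sup>2) \<le> 2 * e\<^sup>2"
    unfolding sqL using L L2 by (simp add: prob_space)
  let ?I = "\<lambda>\<omega>. indicator B (\<lambda>j. X j \<omega>) :: real"
  have I_int: "integrable M ?I"
    by (rule integrable_const_bound[of _ 1]) auto
  have LI_int: "integrable M (\<lambda>\<omega>. ?L \<omega> * ?I \<omega>)"
    by (rule Bochner_Integration.integrable_bound[OF L(1)]) (auto split: split_indicator)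
  have P: "prob {\<omega>\<in>space M. (\<lambda>j. X j \<omega>) \<in> B} = expectation ?I"
  proof -
    have "expectation ?I = expectation (indicator {\<omega>\<in>space M. (\<lambda>j. X j \<omega>) \<in> B})"
      by (intro Bochner_Integration.integral_cong) (auto split: split_indicator)
    then show ?thesis by simp
  qed
  have "emeasure M {\<omega>\<in>space M. (\<lambda>j. ?c j * X j \<omega>) \<in> B}
      = emeasure (distr M (PiM UNIV (\<lambda>_. borel)) (\<lambda>\<omega> j. ?c j * X j \<omega>)) B"
    by (subst emeasure_distr) (auto intro!: arg_cong[where f = "emeasure M"])
  also have "\<dots> = emeasure (distr (density M ?L) (PiM UNIV (\<lambda>_. borel)) (\<lambda>\<omega> j. X j \<omega>)) B"
    using distr_scaled_eq[OF s(1)] by simp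
  also have "\<dots> = emeasure (density M ?L) ((\<lambda>\<omega> j. X j \<omega>) -` B \<inter> space M)"
    by (subst emeasure_distr) auto
  also have "\<dots> = (\<integral>\<^sup>+\<omega>. ennreal (?L \<omega>) * indicator ((\<lambda>\<omega> j. X j \<omega>) -` B \<inter> space M) \<omega> \<partial>M)"
    by (intro emeasure_density) auto
  also have "\<dots> = (\<integral>\<^sup>+\<omega>. ennreal (?L \<omega> * ?I \<omega>) \<partial>M)"
    by (intro nn_integral_cong) (auto split: split_indicator)
  also have "\<dots> = ennreal (expectation (\<lambda>\<omega>. ?L \<omega> * ?I \<omega>))"
    by (intro nn_integral_eq_integral LI_int) auto
  finally have Q: "prob {\<omega>\<in>space M. (\<lambda>j. ?c j * X j \<omega>) \<in> B} = expectation (\<lambda>\<omega>. ?L \<omega> * ?I \<omega>)"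
    by (simp add: emeasure_eq_measure Bochner_Integration.integral_nonneg)
  \<comment> \<open>AM-GM in place of Cauchy-Schwarz for the total variation distance\<close>
  have pt: "?I \<omega> - ?L \<omega> * ?I \<omega> \<le> (?L \<omega> - 1)\<^sup>2 / (2 * e) + e / 2" for \<omega>
  proof -
    have "0 \<le> (\<bar>?L \<omega> - 1\<bar> - e)\<^sup>2"
      by simp
    then have "2 * e * \<bar>?L \<omega> - 1\<bar> \<le> (?L \<omega> - 1)\<^sup>2 + e\<^sup>2"
      by (simp add: power2_eq_square algebra_simps)
    then have "\<bar>?L \<omega> - 1\<bar> \<le> (?L \<omega> - 1)\<^sup>2 / (2 * e) + e / 2"
      using e(1) by (simp add: field_simps power2_eq_square)
    moreover have "?I \<omega> - ?L \<omega> * ?I \<omega> \<le> \<bar>?L \<omega> - 1\<bar>"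
      by (auto split: split_indicator)
    ultimately show ?thesis by linarith
  qed
  have "expectation ?I - expectation (\<lambda>\<omega>. ?L \<omega> * ?I \<omega>) = expectation (\<lambda>\<omega>. ?I \<omega> - ?L \<omega> * ?I \<omega>)"
    using I_int LI_int by simp
  also have "\<dots> \<le> expectation (\<lambda>\<omega>. (?L \<omega> - 1)\<^sup>2 / (2 * e) + e / 2)"
    using I_int LI_int var_int by (intro integral_mono pt) auto
  also have "\<dots> = expectation (\<lambda>\<omega>. (?L \<omega> - 1)\<^sup>2) / (2 * e) + e / 2"
    using var_int by (simp add: prob_space)
  also have "\<dots> \<le> 2 * e\<^sup>2 / (2 * e) + e / 2"
    using e var by (intro add_right_mono divide_right_mono) auto
  also have "\<dots> \<le> 2 * e"
    using e by (simp add: power2_eq_square)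
  finally show ?thesis
    unfolding P Q by simp
qed

end

section \<open>Weighted sums of squares\<close>

lemma exists_step_ge_average:
  fixes F :: "real \<Rightarrow> real" and N :: nat
  assumes "p \<le> F (y + real N * h) - F y" "N \<ge> 1"
  shows "\<exists>z. p / real N \<le> F (z + h) - F z"
proof (rule ccontr)
  assume "\<not> ?thesis"
  then have less: "F (z + h) - F z < p / real N" for z
    by (auto simp: not_le)
  have "F (y + real N * h) - F y = (\<Sum>i<N. F (y + real (Suc i) * h) - F (y + real i * h))"
    by (subst sum_lessThan_telescope) simp
  also have "\<dots> < (\<Sum>i<N. p / real N)"
    using less[of "y + real i * h" for i] assms(2)
    by (intro sum_strict_mono) (auto simp: algebra_simps lessThan_empty_iff)
  also have "\<dots> = p"
    using assms(2) by simp
  finally show False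
    using assms(1) by simp
qed

context std_normal_seq
begin

definition qform :: "(nat \<Rightarrow> real) \<Rightarrow> 'a \<Rightarrow> real" where
  "qform a \<omega> = (\<Sum>j. a j * (X j \<omega>)\<^sup>2)"

definition qcdf :: "(nat \<Rightarrow> real) \<Rightarrow> real \<Rightarrow> real" where
  "qcdf a x = prob {\<omega>\<in>space M. qform a \<omega> \<le> x}"

lemma qform_measurable[measurable]: "qform a \<in> borel_measurable M"
  unfolding qform_def[abs_def] by measurable

lemma qcdf_mono: "x \<le> y \<Longrightarrow> qcdf a x \<le> qcdf a y"
  unfolding qcdf_def by (intro finite_measure_mono) auto

lemma qform_anticoncentration:
  fixes e \<kappa> :: real and k :: nat
  assumes a: "\<And>j. 0 \<le> a j" "summable a" and lower: "\<And>j. j < k \<Longrightarrow> \<kappa> \<le> a j" and \<kappa>: "0 \<le> \<kappa>"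
    and e: "0 < e" "e \<le> 1 / 2" and k: "k \<ge> 1"
  shows "qcdf a t \<le> qcdf a (t - e * sqrt (real k) * \<kappa> / 2) + 2 * e + 8 / real k"
proof -
  define u where "u = e / sqrt (real k)"
  define s where "s = sqrt (1 + u)"
  let ?c = "\<lambda>j. if j < k then s else 1 :: real"
  have u: "u > 0" "u * real k = e * sqrt (real k)"
    using e k by (auto simp: u_def field_simps)
  have s2: "s\<^sup>2 = 1 + u"
    using u by (simp add: s_def)
  let ?B = "{x \<in> space (PiM UNIV (\<lambda>_. borel :: real measure)). (\<Sum>j. a j * (x j)\<^sup>2) \<le> t}"
  have [measurable]: "?B \<in> sets (PiM UNIV (\<lambda>_. borel))"
    by measurable
  define b where "b j = (if j < k then 1 else 0 :: real)" for j
  have bk: "(\<Sum>j. b j * f j) = (\<Sum>j<k. f j)" for f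
  proof -
    have "(\<Sum>j. b j * f j) = (\<Sum>j<k. b j * f j)"
      by (rule suminf_finite) (auto simp: b_def)
    then show ?thesis by (simp add: b_def)
  qed
  have b2: "(\<lambda>j. (b j)\<^sup>2) sums real k"
  proof -
    have "(\<lambda>j. (b j)\<^sup>2) sums (\<Sum>j<k. (b j)\<^sup>2)"
      by (rule sums_finite) (auto simp: b_def)
    then show ?thesis by (simp add: b_def)
  qed
  have bs: "summable (\<lambda>j. b j * f j)" for f
    by (rule summable_finite[of "{..<k}"]) (auto simp: b_def)
  have "qcdf a t = prob {\<omega>\<in>space M. (\<lambda>j. X j \<omega>) \<in> ?B}"
    unfolding qcdf_def qform_def
    by (intro arg_cong[where f = prob]) (auto simp: space_PiM PiE_def extensional_def)
  also have "\<dots> \<le> prob {\<omega>\<in>space M. (\<lambda>j. ?c j * X j \<omega>) \<in> ?B} + 2 * e"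
    unfolding s_def u_def by (rule prob_le_prob_scaled[OF e k]) measurable
  also have "{\<omega>\<in>space M. (\<lambda>j. ?c j * X j \<omega>) \<in> ?B}
      = {\<omega>\<in>space M. (\<Sum>j. a j * (?c j * X j \<omega>)\<^sup>2) \<le> t}"
    by (auto simp: space_PiM PiE_def extensional_def)
  also have "prob \<dots> \<le> qcdf a (t - e * sqrt (real k) * \<kappa> / 2)
      + prob {\<omega>\<in>space M. real k / 2 \<le> \<bar>\<Sum>j. b j * ((X j \<omega>)\<^sup>2 - 1)\<bar>}"
    unfolding qcdf_def
  proof (rule prob_le_add_AE)
    show "{\<omega>\<in>space M. (\<Sum>j. a j * (?c j * X j \<omega>)\<^sup>2) \<le> t} \<in> events" by measurable
    show "{\<omega>\<in>space M. qform a \<omega> \<le> t - e * sqrt (real k) * \<kappa> / 2} \<in> events" by measurable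
    show "{\<omega>\<in>space M. real k / 2 \<le> \<bar>\<Sum>j. b j * ((X j \<omega>)\<^sup>2 - 1)\<bar>} \<in> events" by measurable
    show "AE \<omega> in M. \<omega> \<in> {\<omega>\<in>space M. (\<Sum>j. a j * (?c j * X j \<omega>)\<^sup>2) \<le> t} \<longrightarrow>
      \<omega> \<in> {\<omega>\<in>space M. qform a \<omega> \<le> t - e * sqrt (real k) * \<kappa> / 2} \<or>
      \<omega> \<in> {\<omega>\<in>space M. real k / 2 \<le> \<bar>\<Sum>j. b j * ((X j \<omega>)\<^sup>2 - 1)\<bar>}"
      using AE_summable_squares[OF a]
    proof eventually_elim
      case (elim \<omega>)
      have "a j * (?c j * X j \<omega>)\<^sup>2 = a j * (X j \<omega>)\<^sup>2 + b j * (u * (a j * (X j \<omega>)\<^sup>2))" for j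
        by (simp add: b_def power_mult_distrib s2 algebra_simps)
      then have "(\<Sum>j. a j * (?c j * X j \<omega>)\<^sup>2) = qform a \<omega> + (\<Sum>j. b j * (u * (a j * (X j \<omega>)\<^sup>2)))"
        unfolding qform_def by (simp only: suminf_add[OF elim bs])
      also have "(\<Sum>j. b j * (u * (a j * (X j \<omega>)\<^sup>2))) = (\<Sum>j<k. u * (a j * (X j \<omega>)\<^sup>2))"
        by (rule bk)
      finally have V: "(\<Sum>j. a j * (?c j * X j \<omega>)\<^sup>2) = qform a \<omega> + (\<Sum>j<k. u * (a j * (X j \<omega>)\<^sup>2))" .
      have 1: "u * \<kappa> * (\<Sum>j<k. (X j \<omega>)\<^sup>2) \<le> (\<Sum>j<k. u * (a j * (X j \<omega>)\<^sup>2))"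
        unfolding sum_distrib_left mult.assoc using u lower
        by (intro sum_mono mult_left_mono mult_right_mono) auto
      have 2: "u * \<kappa> * (real k / 2) \<le> u * \<kappa> * (\<Sum>j<k. (X j \<omega>)\<^sup>2)"
        if "\<not> real k / 2 \<le> \<bar>\<Sum>j. b j * ((X j \<omega>)\<^sup>2 - 1)\<bar>"
        using u \<kappa> that by (intro mult_left_mono) (auto simp: bk sum_subtractf abs_if split: if_splits)
      have 3: "u * \<kappa> * (real k / 2) = e * sqrt (real k) * \<kappa> / 2"
        using u(2) by (simp add: algebra_simps)
      have "qform a \<omega> \<le> t - e * sqrt (real k) * \<kappa> / 2"
        if "(\<Sum>j. a j * (?c j * X j \<omega>)\<^sup>2) \<le> t" "\<not> real k / 2 \<le> \<bar>\<Sum>j. b j * ((X j \<omega>)\<^sup>2 - 1)\<bar>"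
        using 1 2[OF that(2)] 3 that(1) unfolding V by linarith
      then show ?case
        by blast
    qed
  qed
  also have "prob {\<omega>\<in>space M. real k / 2 \<le> \<bar>\<Sum>j. b j * ((X j \<omega>)\<^sup>2 - 1)\<bar>}
      \<le> 2 * (\<Sum>j. (b j)\<^sup>2) / (real k / 2)\<^sup>2"
    using k b2 by (intro prob_quadratic_le) (auto simp: sums_iff bs)
  also have "\<dots> = 8 / real k"
    using k b2 by (simp add: sums_iff power2_eq_square field_simps)
  finally show ?thesis by simp
qed

lemma qcdf_chebyshev:
  assumes a: "\<And>j. 0 \<le> a j" "summable a" and a2: "summable (\<lambda>j. (a j)\<^sup>2)" and h: "h > 0"
  shows "1 - 2 * (\<Sum>j. (a j)\<^sup>2) / h\<^sup>2 \<le> qcdf a (suminf a + h) - qcdf a (suminf a - h)"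
proof -
  have conv: "AE \<omega> in M. summable (\<lambda>j. a j * ((X j \<omega>)\<^sup>2 - 1))"
    using AE_summable_squares[OF a]
    by eventually_elim (simp add: right_diff_distrib summable_diff a(2))
  have eq: "AE \<omega> in M. (\<Sum>j. a j * ((X j \<omega>)\<^sup>2 - 1)) = qform a \<omega> - suminf a"
    using AE_summable_squares[OF a]
    by eventually_elim (simp add: right_diff_distrib qform_def suminf_diff a(2))
  let ?E = "{\<omega>\<in>space M. qform a \<omega> \<le> suminf a + h}" and ?L = "{\<omega>\<in>space M. qform a \<omega> \<le> suminf a - h}"
  have "qcdf a (suminf a - h) + (1 - qcdf a (suminf a + h)) = prob ?L + prob (space M - ?E)"
    unfolding qcdf_def by (simp add: prob_compl)
  also have "\<dots> = prob (?L \<union> (space M - ?E))"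
    using h by (intro finite_measure_Union[symmetric]) auto
  also have "\<dots> \<le> prob {\<omega>\<in>space M. h \<le> \<bar>\<Sum>j. a j * ((X j \<omega>)\<^sup>2 - 1)\<bar>}"
  proof (rule finite_measure_mono_AE)
    show "AE \<omega> in M. \<omega> \<in> ?L \<union> (space M - ?E) \<longrightarrow> \<omega> \<in> {\<omega>\<in>space M. h \<le> \<bar>\<Sum>j. a j * ((X j \<omega>)\<^sup>2 - 1)\<bar>}"
      using eq by eventually_elim auto
  qed measurable
  also have "\<dots> \<le> 2 * (\<Sum>j. (a j)\<^sup>2) / h\<^sup>2"
    by (rule prob_quadratic_le[OF a2 conv h])
  finally show ?thesis by simp
qed

lemma prob_shifted_qform:
  fixes th :: "nat \<Rightarrow> real"
  assumes a: "\<And>j. 0 \<le> a j" "summable a" "\<And>j. a j \<le> b" and th: "summable (\<lambda>j. (th j)\<^sup>2)"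
    and tau: "\<tau> > 0" and d: "d > 0"
  defines "A \<equiv> (\<Sum>j. a j * (th j)\<^sup>2)"
  defines "P \<equiv> \<lambda>x. prob {\<omega>\<in>space M. (\<Sum>j. a j * (th j + \<tau> * X j \<omega>)\<^sup>2) \<le> \<tau>\<^sup>2 * x}"
  shows "qcdf a (x - (A + d) / \<tau>\<^sup>2) - 4 * \<tau>\<^sup>2 * b * A / d\<^sup>2 \<le> P x"
    and "P x \<le> qcdf a (x - (A - d) / \<tau>\<^sup>2) + 4 * \<tau>\<^sup>2 * b * A / d\<^sup>2"
proof -
  have sA: "summable (\<lambda>j. a j * (th j)\<^sup>2)"
    by (rule summable_comparison_test'[OF summable_mult[OF th, of b]])
      (use a in \<open>auto intro!: mult_right_mono\<close>)
  have le: "(a j * th j)\<^sup>2 \<le> b * (a j * (th j)\<^sup>2)" for j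
    using mult_right_mono[OF a(3)[of j], of "a j * (th j)\<^sup>2"] a(1)[of j]
    by (simp add: power_mult_distrib power2_eq_square mult_ac)
  have s2: "summable (\<lambda>j. (a j * th j)\<^sup>2)"
    by (rule summable_comparison_test'[OF summable_mult[OF sA, of b]]) (use le in auto)
  have le_A: "(\<Sum>j. (a j * th j)\<^sup>2) \<le> b * A"
    unfolding A_def suminf_mult[OF sA, symmetric] by (intro suminf_le le s2 summable_mult sA)
  have conv: "AE \<omega> in M. summable (\<lambda>j. a j * th j * X j \<omega>)"
    using AE_summable_squares[OF a(1,2)]
  proof eventually_elim
    case (elim \<omega>)
    show ?case
    proof (rule summable_comparison_test'[OF summable_add[OF sA elim]])
      fix j
      have "\<bar>th j * X j \<omega>\<bar> \<le> (th j)\<^sup>2 + (X j \<omega>)\<^sup>2"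
        using sum_squares_bound[of "\<bar>th j\<bar>" "\<bar>X j \<omega>\<bar>"] abs_ge_zero[of "th j * X j \<omega>"]
        unfolding power2_abs abs_mult by linarith
      then show "norm (a j * th j * X j \<omega>) \<le> a j * (th j)\<^sup>2 + a j * (X j \<omega>)\<^sup>2"
        using mult_left_mono[OF _ a(1)[of j]] a(1)[of j]
        by (fastforce simp: abs_mult mult.assoc distrib_left)
    qed
  qed
  let ?U = "\<lambda>\<omega>. \<Sum>j. a j * th j * X j \<omega>"
  let ?D = "{\<omega>\<in>space M. d / (2 * \<tau>) \<le> \<bar>?U \<omega>\<bar>}"
  let ?T = "\<lambda>\<omega>. \<Sum>j. a j * (th j + \<tau> * X j \<omega>)\<^sup>2"
  have eq: "AE \<omega> in M. ?T \<omega> = A + 2 * \<tau> * ?U \<omega> + \<tau>\<^sup>2 * qform a \<omega>"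
    using AE_summable_squares[OF a(1,2)] conv
  proof eventually_elim
    case (elim \<omega>)
    have "a j * (th j + \<tau> * X j \<omega>)\<^sup>2
        = a j * (th j)\<^sup>2 + 2 * \<tau> * (a j * th j * X j \<omega>) + \<tau>\<^sup>2 * (a j * (X j \<omega>)\<^sup>2)" for j
      by (simp add: power2_eq_square algebra_simps)
    then show ?case
      unfolding A_def qform_def
      by (simp only: suminf_add[OF summable_add[OF sA summable_mult[OF elim(2)]] summable_mult[OF elim(1)], symmetric]
           suminf_add[OF sA summable_mult[OF elim(2)], symmetric] suminf_mult[OF elim(1)] suminf_mult[OF elim(2)])
  qed
  have "prob ?D \<le> (\<Sum>j. (a j * th j)\<^sup>2) / (d / (2 * \<tau>))\<^sup>2"
    by (rule prob_linear_le[OF s2 conv]) (use d tau in simp)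
  also have "\<dots> \<le> b * A / (d / (2 * \<tau>))\<^sup>2"
    by (intro divide_right_mono le_A) simp
  also have "\<dots> = 4 * \<tau>\<^sup>2 * b * A / d\<^sup>2"
    by (simp add: power2_eq_square)
  finally have D: "prob ?D \<le> 4 * \<tau>\<^sup>2 * b * A / d\<^sup>2" .
  have small: "\<bar>2 * \<tau> * y\<bar> < d" if "\<not> d / (2 * \<tau>) \<le> \<bar>y\<bar>" for y
    using that tau by (simp add: abs_mult not_le field_simps)
  have le1: "v \<le> x - (A + c) / \<tau>\<^sup>2 \<longleftrightarrow> \<tau>\<^sup>2 * v + A + c \<le> \<tau>\<^sup>2 * x" for v c
    using tau by (simp add: field_simps)
  have "qcdf a (x - (A + d) / \<tau>\<^sup>2) \<le> P x + prob ?D"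
    unfolding qcdf_def P_def le1
  proof (rule prob_le_add_AE)
    show "AE \<omega> in M. \<omega> \<in> {\<omega>\<in>space M. \<tau>\<^sup>2 * qform a \<omega> + A + d \<le> \<tau>\<^sup>2 * x} \<longrightarrow>
        \<omega> \<in> {\<omega>\<in>space M. ?T \<omega> \<le> \<tau>\<^sup>2 * x} \<or> \<omega> \<in> ?D"
      using eq by eventually_elim (use small in fastforce)
  qed measurable
  with D show "qcdf a (x - (A + d) / \<tau>\<^sup>2) - 4 * \<tau>\<^sup>2 * b * A / d\<^sup>2 \<le> P x"
    by linarith
  have "P x \<le> qcdf a (x - (A + - d) / \<tau>\<^sup>2) + prob ?D"
    unfolding qcdf_def P_def le1
  proof (rule prob_le_add_AE)
    show "AE \<omega> in M. \<omega> \<in> {\<omega>\<in>space M. ?T \<omega> \<le> \<tau>\<^sup>2 * x} \<longrightarrow>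
        \<omega> \<in> {\<omega>\<in>space M. \<tau>\<^sup>2 * qform a \<omega> + A + - d \<le> \<tau>\<^sup>2 * x} \<or> \<omega> \<in> ?D"
      using eq by eventually_elim (use small in fastforce)
  qed measurable
  with D show "P x \<le> qcdf a (x - (A - d) / \<tau>\<^sup>2) + 4 * \<tau>\<^sup>2 * b * A / d\<^sup>2"
    by simp
qed

end

section \<open>The weights and the signal\<close>

lemma kn_bounds:
  assumes sm: "summable (\<lambda>j. w (Suc j))"
    and pos: "0 < rho w"
  shows "1 \<le> kn w" and "rho w / 2 < (\<Sum>j\<in>{1..kn w}. w j)"
proof -
  let ?S = "{k. (\<Sum>j\<in>{1..<k}. w j) \<le> rho w / 2}"
  have "(\<lambda>m. \<Sum>j<m. w (Suc j)) \<longlonglongrightarrow> rho w"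
    unfolding rho_def by (rule summable_LIMSEQ[OF sm])
  then have "eventually (\<lambda>m. rho w / 2 < (\<Sum>j<m. w (Suc j))) sequentially"
    by (rule order_tendstoD) (use pos in simp)
  then obtain m0 where m0: "\<And>m. m0 \<le> m \<Longrightarrow> rho w / 2 < (\<Sum>j<m. w (Suc j))"
    by (auto simp: eventually_sequentially)
  have "?S \<subseteq> {..m0}"
  proof
    fix k assume k: "k \<in> ?S"
    show "k \<in> {..m0}"
    proof (rule ccontr)
      assume "k \<notin> {..m0}"
      then obtain m where "k = Suc m" "m0 \<le> m"
        by (cases k) auto
      then show False
        using k m0[of m] by (simp add: atLeastLessThanSuc_atLeastAtMost sum.atLeast1_atMost_eq)
    qed
  qed
  then have fin: "finite ?S"
    using finite_subset by blast
  have one: "1 \<in> ?S"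
    using pos by simp
  have kn: "kn w = Max ?S"
    unfolding kn_def by (rule cSup_eq_Max[OF fin]) (use one in blast)
  show "1 \<le> kn w"
    unfolding kn by (intro Max_ge fin one)
  have "Suc (kn w) \<notin> ?S"
    using Max_ge[OF fin, of "Suc (kn w)"] unfolding kn by auto
  then show "rho w / 2 < (\<Sum>j\<in>{1..kn w}. w j)"
    by (simp add: atLeastLessThanSuc_atLeastAtMost not_le)
qed

lemma weight_bounds:
  assumes nonneg: "\<And>j. 1 \<le> j \<Longrightarrow> 0 \<le> w j" and sm: "summable (\<lambda>j. w (Suc j))"
    and pos: "0 < rho w" and anti: "\<And>i j. 1 \<le> i \<Longrightarrow> i \<le> j \<Longrightarrow> w j \<le> w i"
    and top: "w 1 \<le> b * kappa2 w"
  shows "0 < kappa2 w" "summable (\<lambda>j. (w (Suc j))\<^sup>2)"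
    "rho w \<le> 2 * b * real (kn w) * kappa2 w"
    "real (kn w) * (kappa2 w)\<^sup>2 \<le> (\<Sum>j. (w (Suc j))\<^sup>2)"
    "(\<Sum>j. (w (Suc j))\<^sup>2) \<le> b * kappa2 w * rho w"
proof -
  note k = kn_bounds[OF sm pos]
  let ?\<kappa> = "kappa2 w"
  have \<kappa>0: "0 \<le> ?\<kappa>"
    using nonneg k by (simp add: kappa2_def)
  have "(\<Sum>j\<in>{1..kn w}. w j) \<le> (\<Sum>j\<in>{1..kn w}. w 1)"
    by (intro sum_mono anti) auto
  then have half: "rho w / 2 < real (kn w) * w 1"
    using k by simp
  also have "\<dots> \<le> real (kn w) * (b * ?\<kappa>)"
    by (intro mult_left_mono top) simp
  finally show r: "rho w \<le> 2 * b * real (kn w) * ?\<kappa>"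
    by (simp add: algebra_simps)
  with pos \<kappa>0 show "0 < ?\<kappa>"
    by (cases "?\<kappa> = 0") auto
  have le: "(w (Suc j))\<^sup>2 \<le> w 1 * w (Suc j)" for j
    using anti[of 1 "Suc j"] nonneg[of "Suc j"] by (auto simp: power2_eq_square intro!: mult_right_mono)
  show s2: "summable (\<lambda>j. (w (Suc j))\<^sup>2)"
    by (rule summable_comparison_test'[OF summable_mult[OF sm, of "w 1"]]) (use le in auto)
  have "(\<Sum>j. (w (Suc j))\<^sup>2) \<le> w 1 * rho w"
    unfolding rho_def suminf_mult[OF sm, symmetric] by (intro suminf_le le s2 summable_mult sm)
  also have "\<dots> \<le> b * ?\<kappa> * rho w"
    using top pos by (intro mult_right_mono) auto
  finally show "(\<Sum>j. (w (Suc j))\<^sup>2) \<le> b * ?\<kappa> * rho w" .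
  have "real (kn w) * ?\<kappa>\<^sup>2 = (\<Sum>j<kn w. ?\<kappa>\<^sup>2)"
    by simp
  also have "\<dots> \<le> (\<Sum>j<kn w. (w (Suc j))\<^sup>2)"
    using \<kappa>0 by (intro sum_mono power_mono) (auto simp: kappa2_def intro!: anti)
  also have "\<dots> \<le> (\<Sum>j. (w (Suc j))\<^sup>2)"
    by (intro sum_le_suminf s2) auto
  finally show "real (kn w) * ?\<kappa>\<^sup>2 \<le> (\<Sum>j. (w (Suc j))\<^sup>2)" .
qed

lemma sum_le_suminf_from_1:
  fixes f :: "nat \<Rightarrow> real"
  assumes "finite J" "\<And>j. j \<in> J \<Longrightarrow> 1 \<le> j" "summable (\<lambda>j. f (Suc j))" "\<And>j. 0 \<le> f (Suc j)"
  shows "sum f J \<le> (\<Sum>j. f (Suc j))"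
proof -
  have J: "J = Suc ` (Suc -` J)"
    using assms(2) by (force simp: image_iff Suc_le_eq gr0_conv_Suc)
  then have "sum f J = (\<Sum>j\<in>Suc -` J. f (Suc j))"
    by (metis (no_types, lifting) comp_apply inj_Suc inj_on_subset subset_UNIV sum.cong sum.reindex)
  also have "\<dots> \<le> (\<Sum>j. f (Suc j))"
    using assms by (intro sum_le_suminf finite_vimageI) auto
  finally show ?thesis .
qed

lemma finite_low: "finite {j :: nat. 1 \<le> j \<and> real j < q}"
  by (rule finite_subset[of _ "{..nat \<lceil>q\<rceil>}"]) (auto, linarith)

lemma low_energy_le:
  assumes nonneg: "\<And>j. 1 \<le> j \<Longrightarrow> 0 \<le> w j"
    and anti: "\<And>i j. 1 \<le> i \<Longrightarrow> i \<le> j \<Longrightarrow> w j \<le> w i"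
    and q: "c \<le> q" "Q * kappa2 w \<le> w (nat \<lfloor>q * real (kn w)\<rfloor>)"
    and sA: "summable (\<lambda>j. w (Suc j) * (th (Suc j))\<^sup>2)"
  shows "Q * kappa2 w * (\<Sum>j\<in>{j. 1 \<le> j \<and> real j < c * real (kn w)}. (th j)\<^sup>2)
      \<le> (\<Sum>j. w (Suc j) * (th (Suc j))\<^sup>2)"
proof -
  let ?J = "{j. 1 \<le> j \<and> real j < c * real (kn w)}"
  have "Q * kappa2 w \<le> w j" if "j \<in> ?J" for j
  proof -
    have "real j \<le> q * real (kn w)"
      using that q(1) mult_right_mono[OF q(1), of "real (kn w)"] by auto
    then have "j \<le> nat \<lfloor>q * real (kn w)\<rfloor>"
      by (simp add: le_nat_floor)
    then show ?thesis
      using anti[of j] that q(2) by fastforce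
  qed
  then have "Q * kappa2 w * (\<Sum>j\<in>?J. (th j)\<^sup>2) \<le> (\<Sum>j\<in>?J. w j * (th j)\<^sup>2)"
    unfolding sum_distrib_left by (intro sum_mono mult_right_mono) auto
  also have "\<dots> \<le> (\<Sum>j. w (Suc j) * (th (Suc j))\<^sup>2)"
    by (rule sum_le_suminf_from_1[OF finite_low _ sA]) (auto intro!: nonneg mult_nonneg_nonneg)
  finally show ?thesis .
qed

lemma signal_le_low_energy:
  assumes nonneg: "\<And>j. 1 \<le> j \<Longrightarrow> 0 \<le> w j"
    and anti: "\<And>i j. 1 \<le> i \<Longrightarrow> i \<le> j \<Longrightarrow> w j \<le> w i" and k: "1 \<le> kn w"
    and q: "1 \<le> q" "w (nat \<lfloor>q * real (kn w)\<rfloor>) \<le> D"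
    and sA: "summable (\<lambda>j. w (Suc j) * (th (Suc j))\<^sup>2)"
    and sth: "summable (\<lambda>j. (th (Suc j))\<^sup>2)"
  shows "(\<Sum>j. w (Suc j) * (th (Suc j))\<^sup>2)
      \<le> w 1 * (\<Sum>j\<in>{j. 1 \<le> j \<and> real j < q * real (kn w)}. (th j)\<^sup>2) + D * (\<Sum>j. (th (Suc j))\<^sup>2)"
proof -
  let ?J = "{j. 1 \<le> j \<and> real j < q * real (kn w)}"
  have fl: "1 \<le> nat \<lfloor>q * real (kn w)\<rfloor>"
  proof -
    have "1 * 1 \<le> q * real (kn w)"
      using q k by (intro mult_mono) auto
    then show ?thesis by (simp add: le_nat_floor)
  qed
  then have D: "0 \<le> D"
    using nonneg[OF fl] q by linarith
  let ?h = "\<lambda>j. if j \<in> Suc -` ?J then w 1 * (th (Suc j))\<^sup>2 else 0"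
  have fin: "finite (Suc -` ?J)"
    by (intro finite_vimageI finite_low) auto
  have h: "?h sums (\<Sum>j\<in>Suc -` ?J. w 1 * (th (Suc j))\<^sup>2)"
    using sums_If_finite_set[OF fin, of "\<lambda>j. w 1 * (th (Suc j))\<^sup>2"] by simp
  have "Suc ` (Suc -` ?J) = ?J"
    by (force simp: image_iff Suc_le_eq gr0_conv_Suc)
  then have eq: "(\<Sum>j\<in>Suc -` ?J. w 1 * (th (Suc j))\<^sup>2) = w 1 * (\<Sum>j\<in>?J. (th j)\<^sup>2)"
    using sum.reindex[of Suc "Suc -` ?J" "\<lambda>j. w 1 * (th j)\<^sup>2"] by (simp add: sum_distrib_left)
  have le: "w (Suc j) * (th (Suc j))\<^sup>2 \<le> ?h j + D * (th (Suc j))\<^sup>2" for j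
  proof (cases "Suc j \<in> ?J")
    case True
    have "w (Suc j) * (th (Suc j))\<^sup>2 \<le> w 1 * (th (Suc j))\<^sup>2"
      by (intro mult_right_mono anti) auto
    moreover have "0 \<le> D * (th (Suc j))\<^sup>2"
      using D by simp
    ultimately show ?thesis
      using True by simp
  next
    case False
    then have "nat \<lfloor>q * real (kn w)\<rfloor> \<le> Suc j"
      by simp linarith
    then have "w (Suc j) \<le> D"
      using anti[OF fl, of "Suc j"] q by linarith
    then show ?thesis
      using False by (auto intro!: mult_right_mono)
  qed
  have "(\<Sum>j. w (Suc j) * (th (Suc j))\<^sup>2) \<le> (\<Sum>j. ?h j + D * (th (Suc j))\<^sup>2)"
    by (intro suminf_le le sA summable_add sums_summable[OF h] summable_mult sth)
  also have "\<dots> = w 1 * (\<Sum>j\<in>?J. (th j)\<^sup>2) + D * (\<Sum>j. (th (Suc j))\<^sup>2)"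
    using suminf_add[OF sums_summable[OF h] summable_mult[OF sth, of D]] suminf_mult[OF sth, of D] sums_unique[OF h] eq
    by simp
  finally show ?thesis .
qed

text \<open>Writing the threshold as \<open>\<sigma>\<^sup>2 / n * (x - rho w)\<close> makes acceptance of the hypothesis the event
  that the quadratic form of the noise is at most \<open>x\<close>.\<close>

lemma err_sum_bounds:
  fixes \<xi> :: "nat \<Rightarrow> 'a \<Rightarrow> real" and th :: "nat \<Rightarrow> real"
  assumes seq: "std_normal_seq M (\<lambda>j. \<xi> (Suc j))"
    and nonneg: "\<And>j. 1 \<le> j \<Longrightarrow> 0 \<le> w j" and sm: "summable (\<lambda>j. w (Suc j))"
    and anti: "\<And>i j. 1 \<le> i \<Longrightarrow> i \<le> j \<Longrightarrow> w j \<le> w i"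
    and sth: "summable (\<lambda>j. (th (Suc j))\<^sup>2)" and n: "n \<ge> 1" and \<sigma>: "\<sigma> > 0" and d: "d > 0"
  defines "A \<equiv> (\<Sum>j. w (Suc j) * (th (Suc j))\<^sup>2)"
  defines "F \<equiv> std_normal_seq.qcdf M (\<lambda>j. \<xi> (Suc j)) (\<lambda>j. w (Suc j))"
  defines "v \<equiv> \<sigma>\<^sup>2 / real n"
  defines "err \<equiv> (\<lambda>x. err1 M \<xi> w \<sigma> n (v * (x - rho w)) + err2 M \<xi> w \<sigma> n th (v * (x - rho w)))"
  shows "1 - F x + F (x - (A + d) / v) - 4 * v * w 1 * A / d\<^sup>2 \<le> err x"
    and "err x \<le> 1 - F x + F (x - (A - d) / v) + 4 * v * w 1 * A / d\<^sup>2"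
proof -
  interpret std_normal_seq M "\<lambda>j. \<xi> (Suc j)" by (rule seq)
  define \<tau> where "\<tau> = \<sigma> / sqrt (real n)"
  have \<tau>: "\<tau> > 0" "\<tau>\<^sup>2 = v"
    using n \<sigma> by (auto simp: \<tau>_def v_def power_divide)
  have v: "v > 0"
    using n \<sigma> by (simp add: v_def)
  let ?a = "\<lambda>j. w (Suc j)"
  have a0: "0 \<le> ?a j" for j
    using nonneg by simp
  have aw: "?a j \<le> w 1" for j
    by (rule anti) auto
  have T: "Tstat w \<sigma> n \<theta> y \<le> v * (x - rho w)
      \<longleftrightarrow> (\<Sum>j. ?a j * (\<theta> (Suc j) + \<tau> * y (Suc j))\<^sup>2) \<le> \<tau>\<^sup>2 * x" for \<theta> y
    unfolding Tstat_def \<tau>(2) \<tau>_def[symmetric] v_def[symmetric] by (simp add: algebra_simps)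
  have "err1 M \<xi> w \<sigma> n (v * (x - rho w))
      = prob (space M - {\<omega>\<in>space M. (\<Sum>j. ?a j * (0 + \<tau> * \<xi> (Suc j) \<omega>)\<^sup>2) \<le> \<tau>\<^sup>2 * x})"
    unfolding err1_def by (intro arg_cong[where f = prob]) (auto simp: T not_le[symmetric])
  also have "\<dots> = 1 - prob {\<omega>\<in>space M. (\<Sum>j. ?a j * (0 + \<tau> * \<xi> (Suc j) \<omega>)\<^sup>2) \<le> \<tau>\<^sup>2 * x}"
    by (rule prob_compl) measurable
  also have "prob {\<omega>\<in>space M. (\<Sum>j. ?a j * (0 + \<tau> * \<xi> (Suc j) \<omega>)\<^sup>2) \<le> \<tau>\<^sup>2 * x} = F x"
    unfolding F_def qcdf_def
  proof (rule finite_measure_eq_AE)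
    show "AE \<omega> in M. (\<omega> \<in> {\<omega>\<in>space M. (\<Sum>j. ?a j * (0 + \<tau> * \<xi> (Suc j) \<omega>)\<^sup>2) \<le> \<tau>\<^sup>2 * x})
        = (\<omega> \<in> {\<omega>\<in>space M. qform ?a \<omega> \<le> x})"
      using AE_summable_squares[OF a0 sm]
    proof eventually_elim
      case (elim \<omega>)
      have "(\<Sum>j. ?a j * (0 + \<tau> * \<xi> (Suc j) \<omega>)\<^sup>2) = \<tau>\<^sup>2 * qform ?a \<omega>"
        unfolding qform_def suminf_mult[OF elim, symmetric]
        by (intro suminf_cong) (simp add: power_mult_distrib)
      then show ?case
        using \<tau> v by simp
    qed
  qed measurable
  finally have e1: "err1 M \<xi> w \<sigma> n (v * (x - rho w)) = 1 - F x" .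
  have e2: "err2 M \<xi> w \<sigma> n th (v * (x - rho w))
      = prob {\<omega>\<in>space M. (\<Sum>j. ?a j * (th (Suc j) + \<tau> * \<xi> (Suc j) \<omega>)\<^sup>2) \<le> \<tau>\<^sup>2 * x}"
    unfolding err2_def T ..
  note * = prob_shifted_qform[OF a0 sm aw sth \<tau>(1) d, of x, folded F_def A_def e2, unfolded \<tau>(2)]
  show "1 - F x + F (x - (A + d) / v) - 4 * v * w 1 * A / d\<^sup>2 \<le> err x"
    using *(1) unfolding err_def e1 F_def by simp
  show "err x \<le> 1 - F x + F (x - (A - d) / v) + 4 * v * w 1 * A / d\<^sup>2"
    using *(2) unfolding err_def e1 F_def by simp
qed

lemma one_le_liminf_ereal_iff:
  fixes f :: "nat \<Rightarrow> real"
  shows "1 \<le> liminf (\<lambda>n. ereal (f n)) \<longleftrightarrow> (\<forall>e>0. eventually (\<lambda>n. 1 - e < f n) sequentially)"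
proof
  assume L: "1 \<le> liminf (\<lambda>n. ereal (f n))"
  show "\<forall>e>0. eventually (\<lambda>n. 1 - e < f n) sequentially"
  proof (intro allI impI)
    fix e :: real assume "e > 0"
    then have "ereal (1 - e) < 1"
      by simp
    with L show "eventually (\<lambda>n. 1 - e < f n) sequentially"
      unfolding le_Liminf_iff by fastforce
  qed
next
  assume R: "\<forall>e>0. eventually (\<lambda>n. 1 - e < f n) sequentially"
  show "1 \<le> liminf (\<lambda>n. ereal (f n))"
    unfolding le_Liminf_iff
  proof (intro allI impI)
    fix y :: ereal assume "y < 1"
    then show "eventually (\<lambda>n. y < ereal (f n)) sequentially"
    proof (cases y)
      case (real z)
      then have "eventually (\<lambda>n. 1 - (1 - z) < f n) sequentially"
        using R \<open>y < 1\<close> by (intro R[rule_format]) simp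
      then show ?thesis
        using real by simp
    qed auto
  qed
qed

section \<open>Inconsistent sequences of alternatives\<close>

theorem theorem4:
  fixes \<sigma> r c C :: real and w \<theta> :: "nat \<Rightarrow> nat \<Rightarrow> real"
    and M :: "'a measure" and \<xi> :: "nat \<Rightarrow> 'a \<Rightarrow> real"
  assumes sigma: "\<sigma> > 0" and r: "0 < r" "r < 1/2"
    and M: "prob_space M"
    and indep: "prob_space.indep_vars M (\<lambda>_. borel) \<xi> UNIV"
    and gauss: "\<forall>j. distributed M lborel (\<xi> j) std_normal_density"
    and w_nonneg: "\<forall>n\<ge>1. \<forall>j\<ge>1. 0 \<le> w n j"
    and w_summable: "\<forall>n\<ge>1. summable (\<lambda>j. w n (Suc j))"
    and A1: "\<forall>n\<ge>1. \<forall>i j. 1 \<le> i \<longrightarrow> i \<le> j \<longrightarrow> w n j \<le> w n i"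
    and A2: "\<exists>C1 C2. 0 < C1 \<and> 0 < C2 \<and> (\<forall>n\<ge>1.
               C1 < (real n)\<^sup>2 / \<sigma>^4 * (\<Sum>j. (w n (Suc j))\<^sup>2) \<and>
               (real n)\<^sup>2 / \<sigma>^4 * (\<Sum>j. (w n (Suc j))\<^sup>2) < C2)"
    and A3: "\<exists>c1 c2. 0 < c1 \<and> 0 < c2 \<and> (\<forall>n\<ge>1.
               c1 * real n powr (-2*r) \<le> rho (w n) \<and> rho (w n) \<le> c2 * real n powr (-2*r))"
    and A4: "\<exists>C1 lam. 0 < C1 \<and> 1 < lam \<and> (\<forall>\<delta>>0. \<forall>n\<ge>1.
               w n (nat \<lfloor>(1 + \<delta>) * real (kn (w n))\<rfloor>) < C1 * (1 + \<delta>) powr (-lam) * kappa2 (w n))"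
    and A5a: "\<exists>a b. 0 < a \<and> 0 < b \<and> (\<forall>n\<ge>1.
               a * kappa2 (w n) \<le> w n 1 \<and> w n 1 \<le> b * kappa2 (w n))"
    and A5b: "\<forall>q>1. \<exists>Q>0. \<forall>n\<ge>1. w n (nat \<lfloor>q * real (kn (w n))\<rfloor>) \<ge> Q * kappa2 (w n)"
    and theta_summable: "\<forall>n\<ge>1. summable (\<lambda>j. (\<theta> n (Suc j))\<^sup>2)"
    and cC: "0 < c" "c < C"
    and theta_norm: "\<forall>n\<ge>1. c * real n powr (-r) \<le> sqrt (\<Sum>j. (\<theta> n (Suc j))\<^sup>2) \<and>
                            sqrt (\<Sum>j. (\<theta> n (Suc j))\<^sup>2) \<le> C * real n powr (-r)"
  shows "(\<forall>t :: nat \<Rightarrow> real.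
            liminf (\<lambda>n. ereal (err1 M \<xi> (w n) \<sigma> n (t n) + err2 M \<xi> (w n) \<sigma> n (\<theta> n) (t n))) \<ge> 1)
         \<longleftrightarrow>
         (\<forall>c2>0. (\<lambda>n. \<Sum>j\<in>{j. 1 \<le> j \<and> real j < c2 * real (kn (w n))}. (\<theta> n j)\<^sup>2)
                   \<in> o(\<lambda>n. real n powr (-2*r)))"
proof -
  obtain C1 C2 where C: "0 < C1" "0 < C2"
    and S_bd: "\<And>n. 1 \<le> n \<Longrightarrow> C1 < (real n)\<^sup>2 / \<sigma>^4 * (\<Sum>j. (w n (Suc j))\<^sup>2)"
      "\<And>n. 1 \<le> n \<Longrightarrow> (real n)\<^sup>2 / \<sigma>^4 * (\<Sum>j. (w n (Suc j))\<^sup>2) < C2"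
    using A2 by blast
  obtain c1 c2 where c12: "0 < c1" "0 < c2"
    and rho_bd: "\<And>n. 1 \<le> n \<Longrightarrow> c1 * real n powr (-2*r) \<le> rho (w n)"
      "\<And>n. 1 \<le> n \<Longrightarrow> rho (w n) \<le> c2 * real n powr (-2*r)"
    using A3 by blast
  obtain b where b: "0 < b" and w1: "\<And>n. 1 \<le> n \<Longrightarrow> w n 1 \<le> b * kappa2 (w n)"
    using A5a by blast
  have nonneg: "0 \<le> w n j" if "1 \<le> n" "1 \<le> j" for n j
    using w_nonneg that by blast
  have sm: "summable (\<lambda>j. w n (Suc j))" if "1 \<le> n" for n
    using w_summable that by blast
  have anti: "w n j \<le> w n i" if "1 \<le> n" "1 \<le> i" "i \<le> j" for n i j
    using A1 that by blast
  have sth: "summable (\<lambda>j. (\<theta> n (Suc j))\<^sup>2)" if "1 \<le> n" for n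
    using theta_summable that by blast
  define p where "p n = real n powr (-2*r)" for n
  define k where "k n = kn (w n)" for n
  define \<kappa> where "\<kappa> n = kappa2 (w n)" for n
  define S where "S n = (\<Sum>j. (w n (Suc j))\<^sup>2)" for n
  define A where "A n = (\<Sum>j. w n (Suc j) * (\<theta> n (Suc j))\<^sup>2)" for n
  have p: "0 < p n" if "1 \<le> n" for n
    using that by (simp add: p_def)
  have rho_pos: "0 < rho (w n)" if "1 \<le> n" for n
  proof -
    have "0 < c1 * p n"
      using c12 p[OF that] by simp
    then show ?thesis
      using rho_bd(1)[OF that] unfolding p_def by linarith
  qed
  have k1: "1 \<le> k n" if "1 \<le> n" for n
    unfolding k_def using kn_bounds(1)[OF sm[OF that] rho_pos[OF that]] by simp
  note WB = weight_bounds[where w = "w n" for n, OF nonneg sm rho_pos anti w1, folded k_def \<kappa>_def S_def]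
  have sA: "summable (\<lambda>j. w n (Suc j) * (\<theta> n (Suc j))\<^sup>2)" if "1 \<le> n" for n
    by (rule summable_comparison_test'[OF summable_mult[OF sth[OF that], of "w n 1"]])
      (use that in \<open>auto simp: abs_mult nonneg intro!: mult_right_mono anti\<close>)
  have A0: "0 \<le> A n" if "1 \<le> n" for n
    unfolding A_def using that by (intro suminf_nonneg sA mult_nonneg_nonneg nonneg) auto
  have S_lo: "C1 * \<sigma>^4 \<le> (real n)\<^sup>2 * S n" and S_hi: "(real n)\<^sup>2 * S n \<le> C2 * \<sigma>^4" if "1 \<le> n" for n
    using S_bd[OF that] sigma by (auto simp: S_def field_simps)

  define l where "l = C1 * \<sigma>^4 / (b * c2)"
  define u where "u = 2 * b * C2 * \<sigma>^4 / c1"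
  have l: "0 < l" and u: "0 < u"
    using C c12 b sigma by (auto simp: l_def u_def)
  have \<kappa>_lo: "l \<le> (real n)\<^sup>2 * p n * \<kappa> n" if n: "1 \<le> n" for n
  proof -
    have "S n \<le> b * \<kappa> n * rho (w n)"
      using WB(5)[of n] n by simp
    also have "\<dots> \<le> b * \<kappa> n * (c2 * p n)"
      using WB(1)[of n] rho_bd(2)[OF n] b n by (intro mult_left_mono) (auto simp: p_def)
    finally have "(real n)\<^sup>2 * S n \<le> (real n)\<^sup>2 * (b * \<kappa> n * (c2 * p n))"
      by (intro mult_left_mono) auto
    then have "C1 * \<sigma>^4 \<le> ((real n)\<^sup>2 * p n * \<kappa> n) * (b * c2)"
      using S_lo[OF n] by (simp add: mult_ac)
    then show ?thesis
      unfolding l_def using b c12 by (simp add: divide_le_eq)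
  qed
  have \<kappa>_hi: "(real n)\<^sup>2 * p n * \<kappa> n \<le> u" if n: "1 \<le> n" for n
  proof -
    have "c1 * p n * \<kappa> n \<le> rho (w n) * \<kappa> n"
      using WB(1)[of n] rho_bd(1)[OF n] n by (intro mult_right_mono) (auto simp: p_def)
    also have "\<dots> \<le> (2 * b * real (k n) * \<kappa> n) * \<kappa> n"
      using WB(1)[of n] WB(3)[of n] n by (intro mult_right_mono) auto
    also have "\<dots> \<le> 2 * b * S n"
      using mult_left_mono[OF WB(4)[of n], of "2 * b"] b n by (simp add: power2_eq_square mult_ac)
    finally have "(real n)\<^sup>2 * (c1 * p n * \<kappa> n) \<le> (real n)\<^sup>2 * (2 * b * S n)"
      by (intro mult_left_mono) auto
    also have "\<dots> \<le> 2 * b * (C2 * \<sigma>^4)"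
      using mult_left_mono[OF S_hi[OF n], of "2 * b"] b by (simp add: mult_ac)
    finally show ?thesis
      unfolding u_def using c12 by (simp add: le_divide_eq mult_ac)
  qed
  define g where "g = sqrt (C1 * \<sigma>^4 / (2 * b\<^sup>2))"
  have g: "0 < g"
    using C b sigma by (simp add: g_def)
  have g_le: "g \<le> real n * sqrt (real (k n)) * \<kappa> n" if n: "1 \<le> n" for n
  proof (rule power2_le_imp_le)
    have "S n \<le> b * \<kappa> n * rho (w n)"
      using WB(5)[of n] n by simp
    also have "\<dots> \<le> b * \<kappa> n * (2 * b * real (k n) * \<kappa> n)"
      using WB(1)[of n] WB(3)[of n] b n by (intro mult_left_mono) auto
    finally have "(real n)\<^sup>2 * S n \<le> (real n)\<^sup>2 * (b * \<kappa> n * (2 * b * real (k n) * \<kappa> n))"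
      by (intro mult_left_mono) auto
    then have "C1 * \<sigma>^4 \<le> (real n * sqrt (real (k n)) * \<kappa> n)\<^sup>2 * (2 * b\<^sup>2)"
      using S_lo[OF n] by (simp add: power_mult_distrib power2_eq_square mult_ac)
    moreover have "g\<^sup>2 = C1 * \<sigma>^4 / (2 * b\<^sup>2)"
      using C b sigma by (simp add: g_def)
    ultimately show "g\<^sup>2 \<le> (real n * sqrt (real (k n)) * \<kappa> n)\<^sup>2"
      using b by (simp add: divide_le_eq)
    show "0 \<le> real n * sqrt (real (k n)) * \<kappa> n"
      using WB(1)[of n] n by simp
  qed
  have n_powr: "(\<lambda>n. real n powr x) \<longlonglongrightarrow> 0" if "x < 0" for x
    by (rule tendsto_neg_powr[OF that filterlim_real_sequentially])
  have nw1: "(\<lambda>n. real n * w n 1) \<longlonglongrightarrow> 0"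
  proof (rule tendsto_sandwich[of "\<lambda>_. 0"])
    show "eventually (\<lambda>n. 0 \<le> real n * w n 1) sequentially"
      using eventually_ge_at_top[of 1] by eventually_elim (simp add: nonneg)
    show "eventually (\<lambda>n. real n * w n 1 \<le> b * u * real n powr (2*r - 1)) sequentially"
      using eventually_ge_at_top[of 1]
    proof eventually_elim
      case (elim n)
      have eq: "(real n)\<^sup>2 * p n * real n powr (2*r - 1) = real n"
        using elim by (simp add: p_def powr_add[symmetric] powr_numeral[symmetric] del: powr_numeral)
      have "real n * w n 1 \<le> real n * (b * \<kappa> n)"
        using w1[OF elim] by (intro mult_left_mono) (auto simp: \<kappa>_def)
      also have "\<dots> = b * ((real n)\<^sup>2 * p n * \<kappa> n) * real n powr (2*r - 1)"
        by (subst eq[symmetric]) (simp only: mult_ac)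
      also have "\<dots> \<le> b * u * real n powr (2*r - 1)"
        using \<kappa>_hi[OF elim] b by (intro mult_right_mono mult_left_mono) auto
      finally show ?case .
    qed
    show "(\<lambda>n. b * u * real n powr (2*r - 1)) \<longlonglongrightarrow> 0"
      by (intro tendsto_mult_right_zero n_powr) (use r in simp)
  qed simp
  have kinv: "(\<lambda>n. 1 / real (k n)) \<longlonglongrightarrow> 0"
  proof (rule tendsto_sandwich[of "\<lambda>_. 0"])
    show "eventually (\<lambda>n. 1 / real (k n) \<le> 2 * b * u / c1 * real n powr (4*r - 2)) sequentially"
      using eventually_ge_at_top[of 1]
    proof eventually_elim
      case (elim n)
      have eq: "(real n)\<^sup>2 * p n * real n powr (4*r - 2) * p n = 1"
        using elim by (simp add: p_def powr_add[symmetric] powr_numeral[symmetric] del: powr_numeral)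
      have "c1 * p n \<le> 2 * b * real (k n) * \<kappa> n"
        using rho_bd(1)[OF elim] WB(3)[of n] elim unfolding p_def by linarith
      then have "(real n)\<^sup>2 * p n * real n powr (4*r - 2) * (c1 * p n)
          \<le> (real n)\<^sup>2 * p n * real n powr (4*r - 2) * (2 * b * real (k n) * \<kappa> n)"
        using p[OF elim] by (intro mult_left_mono) auto
      then have "c1 \<le> 2 * b * real (k n) * real n powr (4*r - 2) * ((real n)\<^sup>2 * p n * \<kappa> n)"
        using eq by (simp add: mult_ac)
      also have "\<dots> \<le> 2 * b * real (k n) * real n powr (4*r - 2) * u"
        using \<kappa>_hi[OF elim] b by (intro mult_left_mono) auto
      finally show ?case
        using k1[OF elim] c12 by (simp add: field_simps)
    qed
    show "(\<lambda>n. 2 * b * u / c1 * real n powr (4*r - 2)) \<longlonglongrightarrow> 0"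
      by (intro tendsto_mult_right_zero n_powr) (use r in simp)
  qed auto

  have th_le: "(\<Sum>j. (\<theta> n (Suc j))\<^sup>2) \<le> C\<^sup>2 * p n" if n: "1 \<le> n" for n
  proof -
    have "sqrt (\<Sum>j. (\<theta> n (Suc j))\<^sup>2) \<le> C * real n powr (-r)"
      using theta_norm n by blast
    then have "(sqrt (\<Sum>j. (\<theta> n (Suc j))\<^sup>2))\<^sup>2 \<le> (C * real n powr (-r))\<^sup>2"
      by (intro power_mono) (auto intro!: suminf_nonneg sth n)
    moreover have "0 \<le> (\<Sum>j. (\<theta> n (Suc j))\<^sup>2)"
      by (intro suminf_nonneg sth n) simp
    ultimately show ?thesis
      by (simp add: p_def power_mult_distrib power2_eq_square[of "_ powr _"]
          powr_add[symmetric])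
  qed
  let ?E = "\<lambda>q n. \<Sum>j\<in>{j. 1 \<le> j \<and> real j < q * real (kn (w n))}. (\<theta> n j)\<^sup>2"
  have signal_iff: "(\<forall>q>0. ?E q \<in> o(\<lambda>n. real n powr (-2*r))) \<longleftrightarrow>
      (\<forall>e>0. eventually (\<lambda>n. (real n)\<^sup>2 * A n < e) sequentially)"
  proof safe
    fix e :: real assume low: "\<forall>q>0. ?E q \<in> o(\<lambda>n. real n powr (-2*r))" and e: "e > 0"
    obtain B lam where B: "0 < B" "1 < lam"
      and A4': "\<And>\<delta> n. 0 < \<delta> \<Longrightarrow> 1 \<le> n \<Longrightarrow>
        w n (nat \<lfloor>(1 + \<delta>) * real (kn (w n))\<rfloor>) < B * (1 + \<delta>) powr (-lam) * kappa2 (w n)"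
      using A4 by blast
    define \<delta> where "\<delta> = 1 + 4 * B * u * C\<^sup>2 / e"
    have \<delta>: "1 \<le> \<delta>"
      using B u e by (simp add: \<delta>_def)
    have "(1 + \<delta>) powr (-lam) \<le> (1 + \<delta>) powr (-1)"
      using \<delta> B by (intro powr_mono) auto
    also have "\<dots> \<le> 1 / \<delta>"
      using \<delta> by (simp add: powr_minus_divide divide_le_eq field_simps)
    finally have "B * (1 + \<delta>) powr (-lam) * u * C\<^sup>2 \<le> B * (1 / \<delta>) * u * C\<^sup>2"
      using B u by (intro mult_right_mono mult_left_mono) auto
    also have "\<dots> \<le> e / 4"
    proof -
      have "4 * B * u * C\<^sup>2 \<le> e * \<delta>"
        using e by (simp add: \<delta>_def field_simps)
      then show ?thesis
        using \<delta> by (simp add: field_simps)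
    qed
    finally have tail: "B * (1 + \<delta>) powr (-lam) * u * C\<^sup>2 \<le> e / 4" .
    have "eventually (\<lambda>n. norm (?E (1 + \<delta>) n) \<le> e / (2 * b * u) * norm (real n powr (-2*r))) sequentially"
      using \<delta> e b u by (intro landau_o.smallD[OF low[rule_format]]) auto
    then show "eventually (\<lambda>n. (real n)\<^sup>2 * A n < e) sequentially"
      using eventually_ge_at_top[of 1]
    proof eventually_elim
      case (elim n)
      note n = elim(2)
      let ?D = "B * (1 + \<delta>) powr (-lam) * \<kappa> n"
      have \<kappa>: "0 < \<kappa> n"
        using WB(1)[of n] n by simp
      have E0: "0 \<le> ?E (1 + \<delta>) n"
        by (intro sum_nonneg) simp
      have E: "?E (1 + \<delta>) n \<le> e / (2 * b * u) * p n"
        using elim(1) E0 by (simp add: p_def)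
      have "A n \<le> w n 1 * ?E (1 + \<delta>) n + ?D * (\<Sum>j. (\<theta> n (Suc j))\<^sup>2)"
        unfolding A_def
        using A4'[of \<delta> n] \<delta> n k1[OF n]
        by (intro signal_le_low_energy[OF nonneg[OF n] anti[OF n]] sA sth) (auto simp: k_def \<kappa>_def)
      also have "\<dots> \<le> (b * \<kappa> n) * (e / (2 * b * u) * p n) + ?D * (C\<^sup>2 * p n)"
        using E E0 w1[OF n] th_le[OF n] \<kappa> b B
        by (intro add_mono mult_mono mult_left_mono) (auto simp: \<kappa>_def)
      finally have "(real n)\<^sup>2 * A n \<le> (real n)\<^sup>2 * ((b * \<kappa> n) * (e / (2 * b * u) * p n) + ?D * (C\<^sup>2 * p n))"
        by (intro mult_left_mono) auto
      also have "\<dots> = ((real n)\<^sup>2 * p n * \<kappa> n) * (e / (2 * u) + B * (1 + \<delta>) powr (-lam) * C\<^sup>2)"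
        using b u by (simp add: field_simps)
      also have "\<dots> \<le> u * (e / (2 * u) + B * (1 + \<delta>) powr (-lam) * C\<^sup>2)"
        using \<kappa>_hi[OF n] u e B by (intro mult_right_mono) auto
      also have "\<dots> = e / 2 + B * (1 + \<delta>) powr (-lam) * u * C\<^sup>2"
        using u by (simp add: field_simps)
      also have "\<dots> < e"
        using tail e by linarith
      finally show ?case .
    qed
  next
    fix q :: real
    assume sig: "\<forall>e>0. eventually (\<lambda>n. (real n)\<^sup>2 * A n < e) sequentially" and q: "q > 0"
    have "1 < max q 2"
      by simp
    then obtain Q where Q: "Q > 0" "\<And>n. 1 \<le> n \<Longrightarrow>
        Q * kappa2 (w n) \<le> w n (nat \<lfloor>max q 2 * real (kn (w n))\<rfloor>)"
      using A5b by meson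
    show "?E q \<in> o(\<lambda>n. real n powr (-2*r))"
    proof (rule landau_o.smallI)
      fix e :: real assume e: "e > 0"
      have "eventually (\<lambda>n. (real n)\<^sup>2 * A n < e * Q * l) sequentially"
        using sig e Q l by simp
      then show "eventually (\<lambda>n. norm (?E q n) \<le> e * norm (real n powr (-2*r))) sequentially"
        using eventually_ge_at_top[of 1]
      proof eventually_elim
        case (elim n)
        note n = elim(2)
        have E0: "0 \<le> ?E q n"
          by (intro sum_nonneg) simp
        have "Q * \<kappa> n * ?E q n \<le> A n"
          unfolding A_def \<kappa>_def
          using Q(2)[OF n]
          by (intro low_energy_le[OF nonneg[OF n] anti[OF n], where q = "max q 2"] sA n) auto
        then have "((real n)\<^sup>2 * p n) * (Q * \<kappa> n * ?E q n) \<le> ((real n)\<^sup>2 * p n) * A n"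
          using p[OF n] by (intro mult_left_mono) auto
        also have "\<dots> \<le> p n * (e * Q * l)"
          using mult_left_mono[of "(real n)\<^sup>2 * A n" "e * Q * l" "p n"] elim(1) p[OF n] by (simp add: mult_ac)
        finally have "((real n)\<^sup>2 * p n * \<kappa> n) * (Q * ?E q n) \<le> l * (Q * (e * p n))"
          by (simp add: mult_ac)
        moreover have "l * (Q * ?E q n) \<le> ((real n)\<^sup>2 * p n * \<kappa> n) * (Q * ?E q n)"
          using \<kappa>_lo[OF n] Q E0 by (intro mult_right_mono) auto
        ultimately have "l * (Q * ?E q n) \<le> l * (Q * (e * p n))"
          by linarith
        then show ?case
          using l Q E0 by (simp add: p_def)
      qed
    qed
  qed

  have seq: "std_normal_seq M (\<lambda>j. \<xi> (Suc j))"
    using M gauss prob_space.indep_vars_reindex_inj[OF M indep, of Suc]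
    by (auto simp: std_normal_seq_def std_normal_seq_axioms_def)
  interpret std_normal_seq M "\<lambda>j. \<xi> (Suc j)" by (rule seq)
  let ?a = "\<lambda>n j. w n (Suc j)"
  define v where "v n = \<sigma>\<^sup>2 / real n" for n
  have v: "0 < v n" if "1 \<le> n" for n
    using that sigma by (simp add: v_def)
  let ?err = "\<lambda>t n. err1 M \<xi> (w n) \<sigma> n (t n) + err2 M \<xi> (w n) \<sigma> n (\<theta> n) (t n)"
  note bounds = err_sum_bounds[where w = "w n" and th = "\<theta> n" and n = n for n,
      OF seq nonneg sm anti sth _ sigma, folded A_def v_def]
  have "(\<forall>t. \<forall>e>0. eventually (\<lambda>n. 1 - e < ?err t n) sequentially) \<longleftrightarrow>
      (\<forall>e>0. eventually (\<lambda>n. (real n)\<^sup>2 * A n < e) sequentially)"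
  proof safe
    fix e :: real
    assume inc: "\<forall>t. \<forall>e>0. eventually (\<lambda>n. 1 - e < ?err t n) sequentially" and e: "e > 0"
    define L where "L = 1 + 4 * C2 * \<sigma>^4"
    have L: "1 \<le> L" "4 * C2 * \<sigma>^4 \<le> L\<^sup>2"
    proof -
      show "1 \<le> L" using C by (simp add: L_def)
      then have "L * 1 \<le> L\<^sup>2" unfolding power2_eq_square by (intro mult_left_mono) auto
      then show "4 * C2 * \<sigma>^4 \<le> L\<^sup>2" by (simp add: L_def)
    qed
    define h where "h = e / (2 * \<sigma>\<^sup>2)"
    have h: "h > 0"
      using e sigma by (simp add: h_def)
    define N where "N = Suc (nat \<lceil>2 * L / h\<rceil>)"
    have "2 * L / h \<le> real N"
      unfolding N_def by linarith
    then have N: "1 \<le> N" "2 * L \<le> real N * h"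
      using h by (auto simp: N_def divide_le_eq)
    have "\<exists>z. 1 / (2 * real N) \<le> qcdf (?a n) (z + h / real n) - qcdf (?a n) z" if n: "1 \<le> n" for n
    proof -
      let ?R = "suminf (?a n)"
      have "2 * S n / (L / real n)\<^sup>2 = 2 * ((real n)\<^sup>2 * S n) / L\<^sup>2"
        using n by (simp add: power_divide field_simps)
      also have "\<dots> \<le> 2 * (C2 * \<sigma>^4) / L\<^sup>2"
        using S_hi[OF n] by (intro divide_right_mono mult_left_mono) auto
      also have "\<dots> \<le> 1 / 2"
        using L by (simp add: divide_le_eq)
      finally have "1 / 2 \<le> 1 - 2 * S n / (L / real n)\<^sup>2"
        by simp
      also have "\<dots> \<le> qcdf (?a n) (?R + L / real n) - qcdf (?a n) (?R - L / real n)"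
        unfolding S_def using n L WB(2)[of n] by (intro qcdf_chebyshev nonneg sm) auto
      also have "\<dots> \<le> qcdf (?a n) (?R - L / real n + real N * (h / real n)) - qcdf (?a n) (?R - L / real n)"
      proof -
        have "2 * L / real n \<le> real N * h / real n"
          using N by (intro divide_right_mono) auto
        then show ?thesis
          by (intro diff_right_mono qcdf_mono) simp
      qed
      finally have "1 / 2 \<le> qcdf (?a n) (?R - L / real n + real N * (h / real n)) - qcdf (?a n) (?R - L / real n)" .
      from exists_step_ge_average[OF this N(1)] show ?thesis
        by simp
    qed
    then obtain z where z: "\<And>n. 1 \<le> n \<Longrightarrow>
        1 / (2 * real N) \<le> qcdf (?a n) (z n + h / real n) - qcdf (?a n) (z n)"
      by metis
    define t where "t n = v n * (z n + h / real n - rho (w n))" for n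
    have "eventually (\<lambda>n. 1 - 1 / (4 * real N) < ?err t n) sequentially"
      using inc N by simp
    moreover have "eventually (\<lambda>n. real n * w n 1 < e / (64 * \<sigma>\<^sup>2 * real N)) sequentially"
      using nw1 e sigma N by (intro order_tendstoD) auto
    ultimately show "eventually (\<lambda>n. (real n)\<^sup>2 * A n < e) sequentially"
      using eventually_ge_at_top[of 1]
    proof eventually_elim
      case (elim n)
      note n = elim(3)
      show ?case
      proof (rule ccontr)
        assume "\<not> (real n)\<^sup>2 * A n < e"
        then have Ae: "e \<le> (real n)\<^sup>2 * A n"
          by simp
        then have A: "0 < A n"
          using A0[OF n] e by (cases "A n = 0") auto
        have "h / real n \<le> (A n - A n / 2) / v n"
          using Ae n sigma by (simp add: h_def v_def field_simps power2_eq_square)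
        then have "qcdf (?a n) (z n + h / real n - (A n - A n / 2) / v n) \<le> qcdf (?a n) (z n)"
          by (intro qcdf_mono) simp
        moreover have "?err t n \<le> 1 - qcdf (?a n) (z n + h / real n)
            + qcdf (?a n) (z n + h / real n - (A n - A n / 2) / v n) + 4 * v n * w n 1 * A n / (A n / 2)\<^sup>2"
          unfolding t_def using A n by (intro bounds(2)) auto
        moreover have "4 * v n * w n 1 * A n / (A n / 2)\<^sup>2 < 1 / (4 * real N)"
        proof -
          have "4 * v n * w n 1 * A n / (A n / 2)\<^sup>2 = 16 * \<sigma>\<^sup>2 * (real n * w n 1) / ((real n)\<^sup>2 * A n)"
            using A n by (simp add: v_def power2_eq_square field_simps)
          also have "\<dots> \<le> 16 * \<sigma>\<^sup>2 * (real n * w n 1) / e"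
            using Ae e A n nonneg[OF n, of 1] by (intro divide_left_mono mult_nonneg_nonneg mult_pos_pos) auto
          also have "\<dots> < 1 / (4 * real N)"
            using elim(2) e sigma N by (simp add: field_simps)
          finally show ?thesis .
        qed
        moreover have "1 / (2 * real N) = 1 / (4 * real N) + 1 / (4 * real N)"
          by simp
        ultimately show False
          using z[OF n] elim(1) by linarith
      qed
    qed
  next
    fix t :: "nat \<Rightarrow> real" and e :: real
    assume sig: "\<forall>e>0. eventually (\<lambda>n. (real n)\<^sup>2 * A n < e) sequentially" and e: "e > 0"
    define e' where "e' = min (1 / 2) (e / 8)"
    have e': "0 < e'" "e' \<le> 1 / 2" "e' \<le> e / 8"
      using e by (auto simp: e'_def)
    define d0 where "d0 = \<sigma>\<^sup>2 * e' * g / 4"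
    have d0: "0 < d0"
      using sigma e' g by (simp add: d0_def)
    have "eventually (\<lambda>n. (real n)\<^sup>2 * A n < d0) sequentially"
      using sig d0 by blast
    moreover have "eventually (\<lambda>n. real n * w n 1 < e * d0 / (16 * \<sigma>\<^sup>2)) sequentially"
      using nw1 e sigma d0 by (intro order_tendstoD) auto
    moreover have "eventually (\<lambda>n. 1 / real (k n) < e / 32) sequentially"
      using kinv e by (intro order_tendstoD) auto
    ultimately show "eventually (\<lambda>n. 1 - e < ?err t n) sequentially"
      using eventually_ge_at_top[of 1]
    proof eventually_elim
      case (elim n)
      note n = elim(4)
      define x where "x = t n / v n + rho (w n)"
      have t: "t n = v n * (x - rho (w n))"
        using v[OF n] by (simp add: x_def)
      define h where "h = e' * sqrt (real (k n)) * \<kappa> n / 2"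
      define d where "d = v n * h / 2"
      have "\<sigma>\<^sup>2 * e' * g \<le> \<sigma>\<^sup>2 * e' * (real n * sqrt (real (k n)) * \<kappa> n)"
        using g_le[OF n] e' by (intro mult_left_mono) auto
      then have d: "d0 \<le> (real n)\<^sup>2 * d"
        using n by (simp add: d0_def d_def h_def v_def power2_eq_square field_simps)
      then have "(real n)\<^sup>2 * A n < (real n)\<^sup>2 * d"
        using elim(1) by linarith
      then have Ad: "A n \<le> d"
        using n by simp
      have d_pos: "0 < d"
        using d d0 n zero_less_mult_pos[of "(real n)\<^sup>2" d] by simp
      have "1 - qcdf (?a n) x + qcdf (?a n) (x - (A n + d) / v n) - 4 * v n * w n 1 * A n / d\<^sup>2 \<le> ?err t n"
        unfolding t using n d_pos by (intro bounds(1)) auto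
      moreover have "qcdf (?a n) (x - h) \<le> qcdf (?a n) (x - (A n + d) / v n)"
      proof (rule qcdf_mono)
        have "(A n + d) / v n \<le> (d + d) / v n"
          using Ad v[OF n] by (intro divide_right_mono) auto
        also have "\<dots> = h"
          using v[OF n] by (simp add: d_def)
        finally show "x - h \<le> x - (A n + d) / v n"
          by simp
      qed
      moreover have "qcdf (?a n) x \<le> qcdf (?a n) (x - h) + 2 * e' + 8 / real (k n)"
        unfolding h_def using n k1[OF n] WB(1)[of n] e'
        by (intro qform_anticoncentration nonneg sm) (auto simp: \<kappa>_def kappa2_def k_def intro!: anti)
      moreover have "4 * v n * w n 1 * A n / d\<^sup>2 < e / 4"
      proof -
        have "4 * v n * w n 1 * A n / d\<^sup>2 \<le> 4 * v n * w n 1 * d / d\<^sup>2"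
          using Ad v[OF n] nonneg[OF n, of 1] by (intro divide_right_mono mult_left_mono) auto
        also have "\<dots> = 4 * \<sigma>\<^sup>2 * (real n * w n 1) / ((real n)\<^sup>2 * d)"
          using d_pos n by (simp add: v_def power2_eq_square field_simps)
        also have "\<dots> \<le> 4 * \<sigma>\<^sup>2 * (real n * w n 1) / d0"
          using d d0 d_pos n nonneg[OF n, of 1] by (intro divide_left_mono mult_nonneg_nonneg mult_pos_pos) auto
        also have "\<dots> < e / 4"
          using elim(2) d0 sigma by (simp add: field_simps)
        finally show ?thesis .
      qed
      moreover have "8 / real (k n) < e / 4"
        using elim(3) by simp
      ultimately show ?case
        using e' e by linarith
    qed
  qed
  then show ?thesis
    unfolding one_le_liminf_ereal_iff signal_iff .
qed

end
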